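(* Let $p \geq 2$ be an integer and let $\mathbf{A}$ be a spectrally unitary $\mathbb{Z}^p$-action on $H_1(\mathbb{T}^3, \mathbb{Z}) \cong \mathbb{Z}^3$. Then there exists a free real analytic $\mathbb{Z}^p$-action $\varphi$ on the torus $\mathbb{T}^3 = \mathbb{R}^3/\mathbb{Z}^3$ whose induced action on the first homology group $H_1(\mathbb{T}^3,\mathbb{Z})$ is $\mathbf{A}$.
   Context: A real analytic $\mathbb{Z}^p$-action on $\mathbb{T}^q$ is a group homomorphism $\varphi$ from $\mathbb{Z}^p$ into the group of real analytic diffeomorphisms of $\mathbb{T}^q$. Its induced action $\varphi_*$ is the $\mathbb{Z}^p$-action on $H_1(\mathbb{T}^q,\mathbb{Z}) = \mathbb{Z}^q$ given by $\ell \mapsto \varphi(\ell)_*$ (the map induced on first homology), which acts by automorphisms of $\mathbb{Z}^q$. The action $\varphi$ is free if $\varphi(\ell)$ has no fixed points for every $\ell \in \mathbb{Z}^p \setminus \{0\}$. A $\mathbb{Z}^p$-action $\mathbf{A}$ on $\mathbb{Z}^q$ is spectrally unitary if it acts by automorphisms of $\mathbb{Z}^q$ (i.e. is a homomorphism $\mathbb{Z}^p \to \mathrm{GL}(q,\mathbb{Z})$) and $1$ is an eigenvalue of $\mathbf{A}(\ell)$ for every $\ell \in \mathbb{Z}^p$. *)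

theory Defs
  imports "HOL-Analysis.Analysis"
begin

definition torus_rel :: "real^3 \<Rightarrow> real^3 \<Rightarrow> bool" where
  "torus_rel x y \<longleftrightarrow> (\<forall>i. x$i - y$i \<in> \<int>)"

lemma torus_rel_equivp: "equivp torus_rel"
proof (rule equivpI)
  show "reflp torus_rel" by (auto simp: reflp_def torus_rel_def)
  show "symp torus_rel"
    by (auto simp: symp_def torus_rel_def, metis Ints_minus minus_diff_eq)
  show "transp torus_rel"
    unfolding transp_def torus_rel_def
    by (metis Ints_add diff_add_cancel add_diff_eq)
qed

quotient_type torus = "real^3" / torus_rel
  by (rule torus_rel_equivp)

definition real_of_intvec :: "int^3 \<Rightarrow> real^3" where
  "real_of_intvec k = (\<chi> i. of_int (k$i))"

definition real_analytic_at :: "(real^3 \<Rightarrow> real^3) \<Rightarrow> real^3 \<Rightarrow> bool" where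
  "real_analytic_at F x \<longleftrightarrow>
     (\<exists>r>0. \<exists>c :: (3 \<Rightarrow> nat) \<Rightarrow> real^3.
        \<forall>y\<in>ball x r.
          ((\<lambda>\<alpha>. (\<Prod>i\<in>UNIV. (y$i - x$i) ^ (\<alpha> i)) *\<^sub>R c \<alpha>) has_sum F y) UNIV)"

definition real_analytic :: "(real^3 \<Rightarrow> real^3) \<Rightarrow> bool" where
  "real_analytic F \<longleftrightarrow> (\<forall>x. real_analytic_at F x)"

definition is_lift :: "(real^3 \<Rightarrow> real^3) \<Rightarrow> (torus \<Rightarrow> torus) \<Rightarrow> bool" where
  "is_lift F f \<longleftrightarrow> (\<forall>x. abs_torus (F x) = f (abs_torus x))"

text \<open>A map of T^3 is real analytic iff it has a real analytic lift to R^3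
  (equivalently, it is real analytic in the standard charts).\<close>
definition torus_analytic :: "(torus \<Rightarrow> torus) \<Rightarrow> bool" where
  "torus_analytic f \<longleftrightarrow> (\<exists>F. is_lift F f \<and> real_analytic F)"

definition torus_analytic_diffeo :: "(torus \<Rightarrow> torus) \<Rightarrow> bool" where
  "torus_analytic_diffeo f \<longleftrightarrow> bij f \<and> torus_analytic f \<and> torus_analytic (inv f)"

text \<open>Induced map on H_1(T^3, Z) = Z^3 (generated by the loops t \<mapsto> t e_i):
  for any continuous lift F, F(x + k) = F(x) + M k for all integer vectors k.\<close>
definition H1_induced :: "(torus \<Rightarrow> torus) \<Rightarrow> int^3^3" where
  "H1_induced f = (SOME M. \<exists>F. continuous_on UNIV F \<and> is_lift F f \<and>
      (\<forall>x k. F (x + real_of_intvec k) = F x + real_of_intvec (M *v k)))"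

definition real_analytic_action :: "(int^'p::finite \<Rightarrow> torus \<Rightarrow> torus) \<Rightarrow> bool" where
  "real_analytic_action \<phi> \<longleftrightarrow>
     (\<forall>l. torus_analytic_diffeo (\<phi> l)) \<and>
     (\<forall>l m. \<phi> (l + m) = \<phi> l \<circ> \<phi> m)"

definition free_action :: "(int^'p::finite \<Rightarrow> torus \<Rightarrow> torus) \<Rightarrow> bool" where
  "free_action \<phi> \<longleftrightarrow> (\<forall>l. l \<noteq> 0 \<longrightarrow> (\<forall>x. \<phi> l x \<noteq> x))"

definition has_eigenvalue_one :: "int^3^3 \<Rightarrow> bool" where
  "has_eigenvalue_one M \<longleftrightarrow>
     (\<exists>v::real^3. v \<noteq> 0 \<and> (\<chi> i j. (of_int (M$i$j) :: real)) *v v = v)"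

definition spectrally_unitary :: "(int^'p::finite \<Rightarrow> int^3^3) \<Rightarrow> bool" where
  "spectrally_unitary A \<longleftrightarrow>
     (\<forall>l. invertible (A l)) \<and>
     (\<forall>l m. A (l + m) = A l ** A m) \<and>
     (\<forall>l. has_eigenvalue_one (A l))"

end

theory Submission
  imports Defs
begin

text \<open>The matrices \<open>A l\<close> commute and each has a fixed vector. If they have no common fixed vector,
  they act through the Klein four-group by three sign characters with product 1, and there are
  rational eigenvectors \<open>v1\<close>, \<open>v2\<close>, \<open>v3\<close>. No affine action is free then; instead one composes commuting
  affine maps inducing \<open>A\<close> with the time \<open>\<tau> l\<close> map of the shear flow along
  \<open>cos (2 \<pi> w x) v1 + sin (2 \<pi> w x) v2\<close>, where \<open>w\<close> is the primitive integral covector killing \<open>v1\<close> and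
  \<open>v2\<close>. This field is equivariant and nowhere zero, and its periods form a countable set.

  Otherwise, by duality, there are a common fixed vector \<open>v\<close> and a common fixed covector \<open>w\<close>, and affine
  maps suffice: translations along \<open>v\<close> if \<open>w v \<noteq> 0\<close>, and otherwise explicit cocycles for the
  matrices, which are triangular in a rational flag \<open>v \<in> ker w\<close>. Freeness comes from translation
  lengths built from powers of a transcendental number.\<close>

subsection \<open>Analytic maps\<close>

text \<open>The exponential of a sum is a product of one-variable exponential series; absolute
  convergence allows multiplying them out over all multi-indices.\<close>

lemma has_sum_exp_monomials:
  fixes z :: "'n::finite \<Rightarrow> complex"
  shows "((\<lambda>\<alpha>. \<Prod>i\<in>UNIV. z i ^ \<alpha> i / fact (\<alpha> i)) has_sum exp (\<Sum>i\<in>UNIV. z i)) UNIV"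
proof -
  have abs1: "Infinite_Sum.abs_summable_on (\<lambda>n. z i ^ n / fact n) (UNIV::nat set)" for i
  proof (rule norm_summable_imp_summable_on)
    show "summable (\<lambda>n. norm (norm (z i ^ n / fact n)))"
      using summable_norm_exp[of "z i"]
      by (simp add: scaleR_conv_of_real field_simps norm_divide norm_mult norm_power)
  qed
  have sum1: "infsum (\<lambda>n. z i ^ n / fact n) UNIV = exp (z i)" for i
  proof -
    have "(\<lambda>n. z i ^ n / fact n) summable_on UNIV"
      using abs1 by (rule abs_summable_summable)
    then have "((\<lambda>n. z i ^ n / fact n) has_sum infsum (\<lambda>n. z i ^ n / fact n) UNIV) UNIV" by simp
    then have "(\<lambda>n. z i ^ n / fact n) sums infsum (\<lambda>n. z i ^ n / fact n) UNIV"
      by (rule has_sum_imp_sums)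
    moreover have "(\<lambda>n. z i ^ n / fact n) sums exp (z i)"
      using exp_converges[of "z i"] by (simp add: scaleR_conv_of_real field_simps)
    ultimately show ?thesis by (rule sums_unique2)
  qed
  have "Infinite_Set_Sum.abs_summable_on (\<lambda>\<alpha>. \<Prod>i\<in>UNIV. z i ^ \<alpha> i / fact (\<alpha> i)) (PiE UNIV (\<lambda>_. UNIV))"
    by (rule abs_summable_on_prod_PiE) (use abs1 in \<open>auto simp: abs_summable_equivalent\<close>)
  then have "Infinite_Sum.abs_summable_on (\<lambda>\<alpha>. \<Prod>i\<in>UNIV. z i ^ \<alpha> i / fact (\<alpha> i)) (UNIV :: ('n \<Rightarrow> nat) set)"
    by (simp add: abs_summable_equivalent)
  then have "(\<lambda>\<alpha>. \<Prod>i\<in>UNIV. z i ^ \<alpha> i / fact (\<alpha> i)) summable_on (UNIV :: ('n \<Rightarrow> nat) set)"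
    by (rule abs_summable_summable)
  moreover have "infsum (\<lambda>\<alpha>. \<Prod>i\<in>UNIV. z i ^ \<alpha> i / fact (\<alpha> i)) (PiE UNIV (\<lambda>_. UNIV))
        = (\<Prod>i\<in>UNIV. infsum (\<lambda>n. z i ^ n / fact n) UNIV)"
    by (rule infsum_prod_PiE_abs) (use abs1 in auto)
  ultimately show ?thesis
    by (simp add: sum1 exp_sum has_sum_iff)
qed

lemma real_analytic_at_add:
  assumes "real_analytic_at F x" "real_analytic_at G x"
  shows "real_analytic_at (\<lambda>y. F y + G y) x"
proof -
  obtain r c where r: "r > 0" "\<And>y. y\<in>ball x r \<Longrightarrow>
     ((\<lambda>\<alpha>. (\<Prod>i\<in>UNIV. (y$i - x$i) ^ (\<alpha> i)) *\<^sub>R c \<alpha>) has_sum F y) UNIV"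
    using assms(1) unfolding real_analytic_at_def by blast
  obtain s d where s: "s > 0" "\<And>y. y\<in>ball x s \<Longrightarrow>
     ((\<lambda>\<alpha>. (\<Prod>i\<in>UNIV. (y$i - x$i) ^ (\<alpha> i)) *\<^sub>R d \<alpha>) has_sum G y) UNIV"
    using assms(2) unfolding real_analytic_at_def by blast
  show ?thesis unfolding real_analytic_at_def
  proof (intro exI conjI ballI)
    show "min r s > 0" using r s by simp
    fix y assume "y \<in> ball x (min r s)"
    then show "((\<lambda>\<alpha>. (\<Prod>i\<in>UNIV. (y$i - x$i) ^ (\<alpha> i)) *\<^sub>R (c \<alpha> + d \<alpha>)) has_sum F y + G y) UNIV"
      using has_sum_add[OF r(2) s(2), of y] by (simp add: scaleR_add_right)
  qed
qed

lemma real_analytic_at_const: "real_analytic_at (\<lambda>y. a) x"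
  unfolding real_analytic_at_def
proof (intro exI conjI ballI)
  show "(1::real) > 0" by simp
  fix y :: "real^3"
  show "((\<lambda>\<alpha>. (\<Prod>i\<in>UNIV. (y$i - x$i) ^ (\<alpha> i)) *\<^sub>R (if \<alpha> = (\<lambda>_. 0) then a else 0)) has_sum a) UNIV"
    by (rule has_sum_finite_neutralI[of "{\<lambda>_. 0}"]) auto
qed

lemma real_analytic_at_coordinate: "real_analytic_at (\<lambda>y. y$j *\<^sub>R a) x"
proof -
  have "real_analytic_at (\<lambda>y. (y$j - x$j) *\<^sub>R a) x"
    unfolding real_analytic_at_def
  proof (intro exI conjI ballI)
    show "(1::real) > 0" by simp
    fix y :: "real^3"
    have "(\<Prod>i\<in>UNIV. (y$i - x$i) ^ (if i = j then 1 else 0)) = y$j - x$j"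
      by (simp add: if_distrib[of "\<lambda>n. (_ ^ n)"] cong: if_cong)
    then show "((\<lambda>\<alpha>. (\<Prod>i\<in>UNIV. (y$i - x$i) ^ (\<alpha> i)) *\<^sub>R
        (if \<alpha> = (\<lambda>i. if i = j then 1 else 0) then a else 0)) has_sum (y$j - x$j) *\<^sub>R a) UNIV"
      by (intro has_sum_finite_neutralI[of "{\<lambda>i. if i = j then 1 else 0}"]) auto
  qed
  from real_analytic_at_add[OF this real_analytic_at_const[of "x$j *\<^sub>R a"]]
  show ?thesis by (simp add: scaleR_diff_left)
qed

text \<open>The map is the image of the plane wave \<open>cis (w \<bullet> y)\<close> under the
  real-linear map \<open>L\<close>. Splitting off the constant factor
  \<open>exp (\<i> * (w \<bullet> x))\<close> recentres the exponential series at
  \<open>x\<close>.\<close>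

lemma real_analytic_at_trig:
  fixes w a b :: "real^3"
  shows "real_analytic_at (\<lambda>y. cos (w \<bullet> y) *\<^sub>R a + sin (w \<bullet> y) *\<^sub>R b) x"
  unfolding real_analytic_at_def
proof (intro exI conjI ballI)
  show "(1::real) > 0" by simp
  define L where "L z = Re z *\<^sub>R a + Im z *\<^sub>R b" for z
  define C where "C \<alpha> = exp (\<i> * (w \<bullet> x)) * (\<Prod>i\<in>UNIV. (\<i> * w$i) ^ \<alpha> i / fact (\<alpha> i))" for \<alpha> :: "3 \<Rightarrow> nat"
  fix y :: "real^3"
  have bl: "bounded_linear L"
    unfolding L_def by (intro bounded_linear_intros bounded_linear_Re bounded_linear_Im)
  have "((\<lambda>\<alpha>. \<Prod>i\<in>UNIV. (\<i> * w$i * (y$i - x$i)) ^ \<alpha> i / fact (\<alpha> i)) has_sum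
        exp (\<Sum>i\<in>UNIV. \<i> * w$i * (y$i - x$i))) UNIV"
    by (rule has_sum_exp_monomials)
  then have "((\<lambda>\<alpha>. exp (\<i> * (w \<bullet> x)) * (\<Prod>i\<in>UNIV. (\<i> * w$i * (y$i - x$i)) ^ \<alpha> i / fact (\<alpha> i))) has_sum
        exp (\<i> * (w \<bullet> x)) * exp (\<Sum>i\<in>UNIV. \<i> * w$i * (y$i - x$i))) UNIV"
    by (rule has_sum_cmult_right)
  also have "exp (\<i> * (w \<bullet> x)) * exp (\<Sum>i\<in>UNIV. \<i> * w$i * (y$i - x$i)) = cis (w \<bullet> y)"
    unfolding exp_add[symmetric] cis_conv_exp
    by (rule arg_cong[of _ _ exp]) (simp add: inner_vec_def sum_3 algebra_simps)
  also have "(\<lambda>\<alpha>. exp (\<i> * (w \<bullet> x)) * (\<Prod>i\<in>UNIV. (\<i> * w$i * (y$i - x$i)) ^ \<alpha> i / fact (\<alpha> i)))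
    = (\<lambda>\<alpha>. of_real (\<Prod>i\<in>UNIV. (y$i - x$i) ^ (\<alpha> i)) * C \<alpha>)"
    by (simp add: C_def fun_eq_iff power_mult_distrib prod.distrib prod_dividef of_real_prod)
  finally have "((\<lambda>\<alpha>. L (of_real (\<Prod>i\<in>UNIV. (y$i - x$i) ^ (\<alpha> i)) * C \<alpha>)) has_sum L (cis (w \<bullet> y))) UNIV"
    by (rule has_sum_bounded_linear[OF bl])
  then show "((\<lambda>\<alpha>. (\<Prod>i\<in>UNIV. (y$i - x$i) ^ (\<alpha> i)) *\<^sub>R L (C \<alpha>)) has_sum
       cos (w \<bullet> y) *\<^sub>R a + sin (w \<bullet> y) *\<^sub>R b) UNIV"
    by (simp add: L_def scaleR_add_right del: of_real_prod)
qed

text \<open>This shape covers every lift used below: affine maps, with zero amplitudes, and the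
  lifts of the Klein case.\<close>

lemma real_analytic_affine_trig:
  fixes M :: "real^3^3"
  shows "real_analytic (\<lambda>x. M *v x + s + (cos (w \<bullet> x) *\<^sub>R a + sin (w \<bullet> x) *\<^sub>R b))"
  unfolding real_analytic_def
proof
  fix x
  have M: "M *v y = y$1 *\<^sub>R column 1 M + y$2 *\<^sub>R column 2 M + y$3 *\<^sub>R column 3 M" for y
    by (simp add: matrix_vector_mult_def column_def vec_eq_iff sum_3 mult.commute)
  show "real_analytic_at (\<lambda>x. M *v x + s + (cos (w \<bullet> x) *\<^sub>R a + sin (w \<bullet> x) *\<^sub>R b)) x"
    unfolding M by (intro real_analytic_at_add real_analytic_at_coordinate real_analytic_at_const real_analytic_at_trig)
qed

subsection \<open>Actions from lifts\<close>

lemma abs_torus_eq_iff: "abs_torus x = abs_torus y \<longleftrightarrow> (\<exists>k. x = y + real_of_intvec k)"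
proof -
  have "abs_torus x = abs_torus y \<longleftrightarrow> torus_rel x y"
    by (rule torus.abs_eq_iff)
  also have "\<dots> \<longleftrightarrow> (\<forall>i. \<exists>n. x$i - y$i = of_int n)"
    unfolding torus_rel_def by (auto elim: Ints_cases) (metis Ints_of_int)
  also have "\<dots> \<longleftrightarrow> (\<exists>k. x = y + real_of_intvec k)"
    by (subst choice_iff, auto simp: vec_eq_iff real_of_intvec_def algebra_simps vec_lambda_beta)
      (metis vec_lambda_beta)
  finally show ?thesis .
qed

lemma real_of_intvec_inj: "real_of_intvec k = real_of_intvec k' \<longleftrightarrow> k = k'"
  by (simp add: real_of_intvec_def vec_eq_iff)

lemma real_of_intvec_add: "real_of_intvec (k + k') = real_of_intvec k + real_of_intvec k'"
  by (simp add: real_of_intvec_def vec_eq_iff)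

text \<open>Two continuous lifts of one torus map differ by a continuous integer-valued function,
  constant because the space is connected. So their period matrices agree and the choice in
  \<open>H1_induced\<close> is forced.\<close>

lemma H1_induced_eqI:
  assumes contF: "continuous_on UNIV F" and lift: "is_lift F f"
    and per: "\<And>x k. F (x + real_of_intvec k) = F x + real_of_intvec (M *v k)"
  shows "H1_induced f = M"
  unfolding H1_induced_def
proof (rule some_equality)
  show "\<exists>F. continuous_on UNIV F \<and> is_lift F f \<and>
      (\<forall>x k. F (x + real_of_intvec k) = F x + real_of_intvec (M *v k))"
    using assms by blast
next
  fix N assume "\<exists>F. continuous_on UNIV F \<and> is_lift F f \<and>
      (\<forall>x k. F (x + real_of_intvec k) = F x + real_of_intvec (N *v k))"
  then obtain G where contG: "continuous_on UNIV G" and liftG: "is_lift G f"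
    and perG: "\<And>x k. G (x + real_of_intvec k) = G x + real_of_intvec (N *v k)" by blast
  have ints: "G x $ i - F x $ i \<in> \<int>" for x i
  proof -
    have "abs_torus (G x) = abs_torus (F x)"
      using lift liftG by (simp add: is_lift_def)
    then show ?thesis by (auto simp: abs_torus_eq_iff real_of_intvec_def)
  qed
  have const: "G x $ i - F x $ i = G 0 $ i - F 0 $ i" for x i
  proof -
    have "(\<lambda>x. G x $ i - F x $ i) constant_on UNIV"
    proof (rule continuous_discrete_range_constant)
      show "connected (UNIV :: (real^3) set)" by (rule connected_UNIV)
      show "continuous_on UNIV (\<lambda>x. G x $ i - F x $ i)"
        by (intro continuous_intros contF contG)
      fix x :: "real^3"
      show "\<exists>e>0. \<forall>y. y \<in> UNIV \<and> G y $ i - F y $ i \<noteq> G x $ i - F x $ i \<longrightarrow>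
          e \<le> norm ((G y $ i - F y $ i) - (G x $ i - F x $ i))"
      proof (intro exI[of _ 1] conjI allI impI)
        fix y assume "y \<in> UNIV \<and> G y $ i - F y $ i \<noteq> G x $ i - F x $ i"
        then show "1 \<le> norm ((G y $ i - F y $ i) - (G x $ i - F x $ i))"
          using ints[of y i] ints[of x i]
          by (metis Ints_diff Ints_nonzero_abs_ge1 eq_iff_diff_eq_0 real_norm_def)
      qed simp
    qed
    then show ?thesis unfolding constant_on_def by (metis UNIV_I)
  qed
  have "real_of_intvec (N *v k) = real_of_intvec (M *v k)" for k
  proof -
    have "G (real_of_intvec k) - F (real_of_intvec k) = G 0 - F 0"
      using const by (simp add: vec_eq_iff)
    then show ?thesis using per[of 0 k] perG[of 0 k] by (simp add: algebra_simps)
  qed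
  then have "N *v k = M *v k" for k by (simp add: real_of_intvec_inj)
  then show "N = M"
    by (simp add: matrix_eq)
qed

text \<open>Composition is required only modulo the integer lattice, since the Klein lifts give no
  more. Inverses need no separate argument: \<open>\<phi> (- l)\<close> inverts
  \<open>\<phi> l\<close> and has the analytic lift \<open>F (- l)\<close>.\<close>

lemma action_from_lifts:
  fixes A :: "int^'p::finite \<Rightarrow> int^3^3" and F :: "int^'p \<Rightarrow> real^3 \<Rightarrow> real^3"
  assumes per: "\<And>l x k. F l (x + real_of_intvec k) = F l x + real_of_intvec (A l *v k)"
    and comp: "\<And>l m x. \<exists>k. F (l + m) x = F l (F m x) + real_of_intvec k"
    and zero: "\<And>x. F 0 x = x"
    and analytic: "\<And>l. real_analytic (F l)"
    and cont: "\<And>l. continuous_on UNIV (F l)"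
    and free: "\<And>l x k. l \<noteq> 0 \<Longrightarrow> F l x \<noteq> x + real_of_intvec k"
  shows "\<exists>\<phi> :: int^'p \<Rightarrow> torus \<Rightarrow> torus.
           real_analytic_action \<phi> \<and> free_action \<phi> \<and> (\<forall>l. H1_induced (\<phi> l) = A l)"
proof (intro exI conjI allI)
  define \<phi> where "\<phi> l t = abs_torus (F l (rep_torus t))" for l t
  have abs_rep: "abs_torus (rep_torus t) = t" for t
    by (meson Quotient_abs_rep Quotient_torus)
  have \<phi>: "\<phi> l (abs_torus x) = abs_torus (F l x)" for l x
  proof -
    obtain k where "rep_torus (abs_torus x) = x + real_of_intvec k"
      using abs_rep[of "abs_torus x"] by (auto simp: abs_torus_eq_iff)
    then show ?thesis
      unfolding \<phi>_def by (auto simp: abs_torus_eq_iff per)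
  qed
  have surj: "\<exists>x. t = abs_torus x" for t by (metis abs_rep)
  have lift: "is_lift (F l) (\<phi> l)" for l by (simp add: is_lift_def \<phi>)
  have hom: "\<phi> (l + m) = \<phi> l \<circ> \<phi> m" for l m
  proof
    fix t obtain x where "t = abs_torus x" using surj by blast
    then show "\<phi> (l + m) t = (\<phi> l \<circ> \<phi> m) t" using comp[of l m x] by (simp add: \<phi> abs_torus_eq_iff)
  qed
  have id: "\<phi> 0 = id"
  proof
    fix t show "\<phi> 0 t = id t" using surj[of t] by (auto simp: \<phi> zero)
  qed
  have inv: "\<phi> l \<circ> \<phi> (- l) = id" "\<phi> (- l) \<circ> \<phi> l = id" for l
    by (simp_all flip: hom add: id)
  have tan: "torus_analytic (\<phi> l)" for l
    using lift analytic by (auto simp: torus_analytic_def)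
  have "torus_analytic_diffeo (\<phi> l)" for l
    unfolding torus_analytic_diffeo_def
    using o_bij[OF inv(2,1), of l] inv_unique_comp[OF inv, of l] tan by simp
  then show "real_analytic_action \<phi>"
    using hom by (simp add: real_analytic_action_def)
  show "free_action \<phi>"
    unfolding free_action_def
  proof (intro allI impI)
    fix l t assume "l \<noteq> (0 :: int^'p)"
    moreover obtain x where "t = abs_torus x" using surj by blast
    ultimately show "\<phi> l t \<noteq> t" using free by (simp add: \<phi> abs_torus_eq_iff)
  qed
  show "H1_induced (\<phi> l) = A l" for l
    using cont lift per by (rule H1_induced_eqI)
qed

subsection \<open>Generic translation lengths\<close>

text \<open>Integer polynomials are encoded by coefficient lists, which form a countable type, and
  each nonzero one has finitely many roots. This supplies a transcendental number.\<close>

lemma countable_algebraic_real: "countable {x :: real. algebraic x}"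
proof (rule countable_subset)
  show "{x :: real. algebraic x} \<subseteq>
    (\<Union>cs \<in> {cs :: int list. Poly (map real_of_int cs) \<noteq> 0}. {x. poly (Poly (map real_of_int cs)) x = 0})"
  proof
    fix x :: real assume "x \<in> {x. algebraic x}"
    then obtain p where p: "\<And>i. coeff p i \<in> \<int>" "p \<noteq> 0" "poly p x = 0"
      unfolding algebraic_def by blast
    define cs where "cs = map floor (coeffs p)"
    have "map real_of_int cs = map (\<lambda>c. c) (coeffs p)"
      unfolding cs_def map_map
    proof (rule map_cong[OF refl])
      fix c assume "c \<in> set (coeffs p)"
      then obtain i where "c = coeff p i" by (auto simp: coeffs_def split: if_splits)
      then show "(real_of_int \<circ> floor) c = c" using p(1)[of i] by (auto elim: Ints_cases)
    qed
    then have "Poly (map real_of_int cs) = p" by simp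
    then show "x \<in> (\<Union>cs \<in> {cs :: int list. Poly (map real_of_int cs) \<noteq> 0}. {x. poly (Poly (map real_of_int cs)) x = 0})"
      using p by (intro UN_I[of cs]) auto
  qed
  show "countable (\<Union>cs \<in> {cs :: int list. Poly (map real_of_int cs) \<noteq> 0}. {x. poly (Poly (map real_of_int cs)) x = 0})"
    by (intro countable_UN countableI_type countable_finite poly_roots_finite) simp
qed

text \<open>For a transcendental \<theta>, take \<theta> itself as \<kappa>, and as
  \<open>\<tau> l\<close> the value at \<theta> of a polynomial \<open>P l\<close> whose
  coefficients are the entries of \<open>l\<close>. A rational polynomial relation at \<theta> must
  then hold coefficientwise.\<close>

lemma exists_generic_frequencies:
  obtains \<kappa> :: real and \<tau> :: "int^'p::finite \<Rightarrow> real"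
  where "\<And>l m. \<tau> (l + m) = \<tau> l + \<tau> m"
    and "\<And>r q l. r \<in> \<rat> \<Longrightarrow> q \<in> \<rat> \<Longrightarrow> \<kappa> * r + q * \<tau> l \<in> \<rat> \<Longrightarrow> r = 0 \<and> (q = 0 \<or> l = 0)"
    and "\<And>l. (\<tau> l)\<^sup>2 \<in> \<rat> \<Longrightarrow> l = 0"
proof -
  obtain \<theta> :: real where \<theta>: "\<not> algebraic \<theta>"
    using uncountable_UNIV_real countable_algebraic_real
    by (metis (mono_tags, lifting) UNIV_eq_I mem_Collect_eq)
  have trans: "p = 0" if "\<And>i. coeff p i \<in> \<rat>" "poly p \<theta> = 0" for p
    using \<theta> that unfolding algebraic_altdef by blast
  obtain e :: "'p \<Rightarrow> nat" where e: "inj e"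
    using finite_imp_inj_to_nat_seg[OF finite[of "UNIV :: 'p set"]] by blast
  \<comment> \<open>Degrees start at 2: degree 0 is kept for rational numbers and degree 1 for
    \<kappa>.\<close>
  define P where "P l = (\<Sum>i\<in>UNIV. monom (real_of_int (l$i)) (e i + 2))" for l
  define \<tau> where "\<tau> l = poly (P l) \<theta>" for l
  have coeff_P: "coeff (P l) n = (\<Sum>i\<in>UNIV. if e i + 2 = n then real_of_int (l$i) else 0)" for l n
    unfolding P_def coeff_sum coeff_monom ..
  have coeff_Pi: "coeff (P l) (e i + 2) = real_of_int (l$i)" for l i
    unfolding coeff_P using e by (simp add: inj_eq)
  have coeff_P1: "coeff (P l) (Suc 0) = 0" for l unfolding coeff_P by simp
  have rat: "coeff (P l) n \<in> \<rat>" for l n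
    unfolding coeff_P by (intro Rats_sum) auto
  show thesis
  proof
    show "\<tau> (l + m) = \<tau> l + \<tau> m" for l m
      by (simp add: \<tau>_def P_def poly_sum poly_monom sum.distrib algebra_simps)
    show "r = 0 \<and> (q = 0 \<or> l = 0)" if "r \<in> \<rat>" "q \<in> \<rat>" "\<theta> * r + q * \<tau> l \<in> \<rat>" for r q l
    proof -
      define c where "c = \<theta> * r + q * \<tau> l"
      define p where "p = monom r 1 + smult q (P l) - [:c:]"
      have "p = 0"
      proof (rule trans)
        show "poly p \<theta> = 0" by (simp add: p_def c_def \<tau>_def poly_monom)
        show "coeff p i \<in> \<rat>" for i
          using that rat by (auto simp: p_def c_def coeff_pCons split: nat.splits)
      qed
      then have "coeff p 1 = 0" "\<And>i. coeff p (e i + 2) = 0" by simp_all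
      then show ?thesis
        by (auto simp: p_def coeff_P1 coeff_Pi[simplified] vec_eq_iff)
    qed
    show "l = 0" if "(\<tau> l)\<^sup>2 \<in> \<rat>" for l
    proof -
      \<comment> \<open>If the value were rational, the square of \<open>P l\<close> would be
        constant, hence so would \<open>P l\<close>, although all its monomials have degree at least
        2.\<close>
      have "(P l)\<^sup>2 - [:(\<tau> l)\<^sup>2:] = 0"
      proof (rule trans)
        show "poly ((P l)\<^sup>2 - [:(\<tau> l)\<^sup>2:]) \<theta> = 0" by (simp add: \<tau>_def)
        show "coeff ((P l)\<^sup>2 - [:(\<tau> l)\<^sup>2:]) i \<in> \<rat>" for i
          using that rat by (auto simp: coeff_pCons power2_eq_square coeff_mult
            intro!: Rats_diff Rats_add Rats_sum Rats_mult split: nat.splits)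
      qed
      then have "degree ((P l)\<^sup>2) = 0" by simp
      then have "degree (P l) = 0" by (auto simp: power2_eq_square degree_mult_eq_0)
      then have "coeff (P l) (e i + 2) = 0" for i by (intro coeff_eq_0) simp
      then show ?thesis by (simp add: coeff_Pi[simplified] vec_eq_iff)
    qed
  qed
qed

subsection \<open>Commuting matrices that all have a fixed vector\<close>

definition indep3 :: "'a::field^3 \<Rightarrow> 'a^3 \<Rightarrow> 'a^3 \<Rightarrow> bool" where
  "indep3 u v w \<longleftrightarrow> (\<forall>a b c. a *s u + b *s v + c *s w = 0 \<longrightarrow> a = 0 \<and> b = 0 \<and> c = 0)"

definition columns3 :: "'a^3 \<Rightarrow> 'a^3 \<Rightarrow> 'a^3 \<Rightarrow> 'a^3^3" where
  "columns3 u v w = (\<chi> i j. if j = 1 then u$i else if j = 2 then v$i else w$i)"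

lemma columns3_mult: "columns3 u v w *v x = x$1 *s u + x$2 *s v + x$3 *s w"
  for u v w :: "'a::comm_semiring_1^3"
  by (simp add: columns3_def matrix_vector_mult_def vec_eq_iff sum_3 mult.commute)

lemma matrix_mult_columns3: "M ** columns3 u v w = columns3 (M *v u) (M *v v) (M *v w)"
  for M :: "'a::comm_semiring_1^3^3"
  by (simp add: columns3_def matrix_matrix_mult_def matrix_vector_mult_def vec_eq_iff)

lemma invertible_columns3: "invertible (columns3 u v w) \<longleftrightarrow> indep3 u v w"
  for u v w :: "'a::field^3"
proof -
  have "invertible (columns3 u v w) \<longleftrightarrow> (\<forall>x. columns3 u v w *v x = 0 \<longrightarrow> x = 0)"
    unfolding invertible_left_inverse matrix_left_invertible_ker ..
  also have "\<dots> \<longleftrightarrow> indep3 u v w"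
    unfolding indep3_def columns3_mult
    by (auto simp: vec_eq_iff forall_3 dest: spec[of _ "vector [_, _, _]"])
  finally show ?thesis .
qed

lemma indep3_span:
  fixes u v w :: "'a::field^3"
  assumes "indep3 u v w"
  obtains a b c where "x = a *s u + b *s v + c *s w"
proof -
  obtain Q where "columns3 u v w ** Q = mat 1"
    using assms by (auto simp: invertible_columns3[symmetric] invertible_def)
  then have "x = columns3 u v w *v (Q *v x)"
    by (simp add: matrix_vector_mul_assoc)
  then show ?thesis using that unfolding columns3_mult by blast
qed

lemma indep3I:
  fixes u v w :: "'a::field^3"
  assumes "u \<noteq> 0" "\<And>c. v \<noteq> c *s u" "\<And>c d. w \<noteq> c *s u + d *s v"
  shows "indep3 u v w"
  unfolding indep3_def
proof (intro allI impI)
  fix a b c assume *: "a *s u + b *s v + c *s w = 0"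
  have "c = 0"
  proof (rule ccontr)
    assume "c \<noteq> 0"
    then have "w = (- a / c) *s u + (- b / c) *s v"
      using * by (simp add: vec_eq_iff field_simps) (metis add.assoc add.commute add_eq_0_iff)
    then show False using assms by blast
  qed
  moreover have "b = 0"
  proof (rule ccontr)
    assume "b \<noteq> 0"
    then have "v = (- a / b) *s u"
      using * \<open>c = 0\<close> by (simp add: vec_eq_iff field_simps) (metis add.commute add_eq_0_iff)
    then show False using assms by blast
  qed
  ultimately show "a = 0 \<and> b = 0 \<and> c = 0" using * assms(1) by (simp add: vec_eq_iff)  metis
qed

lemma indep3_nonzero:
  assumes "indep3 u v w"
  shows "u \<noteq> 0" "v \<noteq> 0" "w \<noteq> 0"
proof -
  have "a = 0 \<and> b = 0 \<and> c = 0" if "a *s u + b *s v + c *s w = 0" for a b c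
    using assms that unfolding indep3_def by blast
  from this[of 1 0 0] this[of 0 1 0] this[of 0 0 1]
  show "u \<noteq> 0" "v \<noteq> 0" "w \<noteq> 0" by auto
qed

lemma indep3_coords_eq:
  assumes "indep3 u v w" "a *s u + b *s v + c *s w = a' *s u + b' *s v + c' *s w"
  shows "a = a'" "b = b'" "c = c'"
proof -
  have "(a - a') *s u + (b - b') *s v + (c - c') *s w = 0"
    using assms(2) by (simp add: vec_eq_iff algebra_simps)
  with assms(1) have "a - a' = 0" "b - b' = 0" "c - c' = 0" unfolding indep3_def by blast+
  then show "a = a'" "b = b'" "c = c'" by simp_all
qed

text \<open>Either \<open>p'\<close> already lies in the first plane, or \<open>p\<close>,
  \<open>q\<close>, \<open>p'\<close> form a basis, and subtracting from \<open>q'\<close> its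
  \<open>p'\<close> component gives a vector of both planes.\<close>

lemma planes_meet:
  fixes p q p' q' :: "'a::field^3"
  assumes "p \<noteq> 0" "\<And>c. q \<noteq> c *s p" "p' \<noteq> 0" "\<And>c. q' \<noteq> c *s p'"
  obtains a b a' b' where "a *s p + b *s q = a' *s p' + b' *s q'" "a *s p + b *s q \<noteq> 0"
proof (cases "\<exists>a b. p' = a *s p + b *s q")
  case True
  then obtain a b where "p' = a *s p + b *s q" by blast
  then show ?thesis using that[of a b 1 0] assms by simp
next
  case False
  then have "indep3 p q p'" using assms by (intro indep3I) auto
  then obtain a b c where q': "q' = a *s p + b *s q + c *s p'" by (rule indep3_span)
  then have "a *s p + b *s q \<noteq> 0" using assms(4)[of c] by auto
  moreover have "a *s p + b *s q = (- c) *s p' + 1 *s q'" using q' by (simp add: vec_eq_iff)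
  ultimately show ?thesis using that by blast
qed

lemma eq_uminus_self_iff: "x = - x \<longleftrightarrow> x = 0" "- x = x \<longleftrightarrow> x = 0" for x :: "rat^3"
  by (auto simp: vec_eq_iff equation_minus_iff)

lemma mvmult_lin: "M *v (a *s x + b *s y) = a *s (M *v x) + b *s (M *v y)"
  "M *v (a *s x) = a *s (M *v x)" for M :: "'a::field^'n^'m"
  by (simp_all add: matrix_vector_right_distrib vector_scalar_commute)

text \<open>If an element fixes exactly a line, commutation makes that line invariant under all
  \<open>M l\<close>, so it carries a sign character. Three such elements \<open>g\<close>,
  \<open>k\<close>, \<open>m\<close> are found in turn, \<open>k\<close> negating \<open>v1\<close>,
  and \<open>m\<close> negating \<open>v1\<close> and \<open>v2\<close>.\<close>

theorem commuting_fixing_family_structure: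
  fixes M :: "'g::ab_group_add \<Rightarrow> rat^3^3"
  assumes hom: "\<And>l m. M (l + m) = M l ** M m"
    and fixes_some: "\<And>l. \<exists>v. v \<noteq> 0 \<and> M l *v v = v"
    and eigen: "\<And>l v c. v \<noteq> 0 \<Longrightarrow> M l *v v = c *s v \<Longrightarrow> c = 1 \<or> c = -1"
    and no_common: "\<And>v. v \<noteq> 0 \<Longrightarrow> \<exists>l. M l *v v \<noteq> v"
  obtains v1 v2 v3 c1 c2 c3 k m where "indep3 v1 v2 v3"
    "\<And>l. M l *v v1 = c1 l *s v1" "\<And>l. M l *v v2 = c2 l *s v2" "\<And>l. M l *v v3 = c3 l *s v3"
    "c1 k = -1" "c2 k = 1" "c3 k = -1" "c1 m = -1" "c2 m = -1" "c3 m = 1"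
proof -
  have homv: "M (l + m) *v x = M l *v (M m *v x)" for l m x
    by (simp add: hom matrix_vector_mul_assoc)
  have comm: "M l *v (M m *v x) = M m *v (M l *v x)" for l m x
    by (metis homv add.commute)
  have negv: "N *v (- x) = - (N *v x)" for N :: "rat^3^3" and x
    by (simp add: vec_eq_iff matrix_vector_mult_def sum_negf)
  have char: "\<exists>c. (\<forall>l. M l *v v = c l *s v)"
    if "\<And>l. \<exists>c. M l *v v = c *s v" for v
    using that by metis
  have pm: "M l *v v = v \<or> M l *v v = - v" if "v \<noteq> 0" "\<exists>c. M l *v v = c *s v" for l v
    using eigen that by (metis vector_smult_lid vector_sneg_minus1)
  have neg: "\<exists>l. M l *v v = - v" if "v \<noteq> 0" "\<And>l. \<exists>c. M l *v v = c *s v" for v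
    using pm[OF that(1)] that(2) no_common[OF that(1)] by metis
  have not_mult: "\<And>c. b \<noteq> c *s a" if "M k *v a = - a" "M k *v b = b" "b \<noteq> 0" for k a b
  proof
    fix c assume "b = c *s a"
    then have "M k *v b = - b" using that by (simp add: mvmult_lin)
    then show False using that by (simp add: eq_uminus_self_iff)
  qed
  \<comment> \<open>Some element fixes exactly a line: if all fixed spaces had dimension at least 2, then inside
    a fixed plane of some \<open>g\<close> every element would still fix a vector, and two sign characters
    on that plane would have kernels covering the whole group.\<close>
  have "\<exists>g v. v \<noteq> 0 \<and> M g *v v = v \<and> (\<forall>x. M g *v x = x \<longrightarrow> (\<exists>c. x = c *s v))"
  proof (rule ccontr)
    assume no_line: "\<not> ?thesis"
    have plane: "\<exists>p q. p \<noteq> 0 \<and> (\<forall>c. q \<noteq> c *s p) \<and> M h *v p = p \<and> M h *v q = q" for h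
      using fixes_some[of h] no_line by blast
    have "axis 1 1 \<noteq> (0::rat^3)" by (simp add: axis_eq_0_iff)
    then obtain g p0 where g: "M g *v p0 \<noteq> p0" using no_common by blast
    \<comment> \<open>Since \<open>g\<close> moves \<open>p0\<close>, its fixed space is at most a
      plane.\<close>
    have gspan: "\<exists>c d. x = c *s a + d *s b"
      if "M g *v a = a" "M g *v b = b" "M g *v x = x" "a \<noteq> 0" "\<And>c. b \<noteq> c *s a" for a b x
    proof (rule ccontr)
      assume "\<not> ?thesis"
      then have "indep3 a b x" using that by (intro indep3I) auto
      then obtain c d e where p0: "p0 = c *s a + d *s b + e *s x" by (rule indep3_span)
      have "M g *v p0 = p0"
        unfolding p0 by (simp add: matrix_vector_right_distrib mvmult_lin that)
      with g show False by simp
    qed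
    have meet: "\<exists>x. x \<noteq> 0 \<and> M g *v x = x \<and> M h *v x = x" for h
    proof -
      obtain p q where pq: "p \<noteq> 0" "\<And>c. q \<noteq> c *s p" "M g *v p = p" "M g *v q = q"
        using plane[of g] by blast
      obtain p' q' where pq': "p' \<noteq> 0" "\<And>c. q' \<noteq> c *s p'" "M h *v p' = p'" "M h *v q' = q'"
        using plane[of h] by blast
      obtain a b a' b' where eq: "a *s p + b *s q = a' *s p' + b' *s q'" "a *s p + b *s q \<noteq> 0"
        using planes_meet[OF pq(1,2) pq'(1,2)] by blast
      have "M g *v (a *s p + b *s q) = a *s p + b *s q" by (simp add: mvmult_lin pq)
      moreover have "M h *v (a *s p + b *s q) = a *s p + b *s q"
        unfolding eq by (simp add: mvmult_lin pq')
      ultimately show ?thesis using eq by blast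
    qed
    obtain p where p: "p \<noteq> 0" "M g *v p = p" using fixes_some by blast
    then obtain h where h: "M h *v p \<noteq> p" using no_common by blast
    obtain a where a: "a \<noteq> 0" "M g *v a = a" "M h *v a = a" using meet by blast
    \<comment> \<open>The common fixed space of \<open>g\<close> and \<open>h\<close> is invariant
      under all \<open>M l\<close>. Were it larger than the line of \<open>a\<close>, it would be
      the whole fixed plane of \<open>g\<close> and contain \<open>p\<close>, which \<open>h\<close>
      moves.\<close>
    have "\<exists>c. M l *v a = c *s a" for l
    proof (rule ccontr)
      assume "\<nexists>c. M l *v a = c *s a"
      moreover have fixed: "M g *v (M l *v a) = M l *v a" "M h *v (M l *v a) = M l *v a"
        using a comm by metis+
      ultimately obtain c d where "p = c *s a + d *s (M l *v a)"
        using gspan[of a "M l *v a" p] a p by blast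
      then have "M h *v p = p" by (simp add: mvmult_lin a fixed)
      with h show False by simp
    qed
    note a_eig = this
    obtain k where k: "M k *v a = - a" using neg[OF a(1) a_eig] by blast
    obtain b where b: "b \<noteq> 0" "M g *v b = b" "M k *v b = b" using meet by blast
    have ba: "\<And>c. b \<noteq> c *s a" using not_mult k b by blast
    \<comment> \<open>\<open>M l *v b\<close> lies in the fixed plane of \<open>g\<close> and is
      fixed by \<open>k\<close>, which negates \<open>a\<close>; so it has no component along
      \<open>a\<close>.\<close>
    have b_eig: "\<exists>c. M l *v b = c *s b" for l
    proof -
      have fixed: "M g *v (M l *v b) = M l *v b" "M k *v (M l *v b) = M l *v b"
        using b comm by metis+
      then obtain c d where cd: "M l *v b = c *s a + d *s b"
        using gspan[of a b "M l *v b"] a b ba by blast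
      then have "c *s a + d *s b = (- c) *s a + d *s b"
        using fixed(2) by (simp add: mvmult_lin k b)
      then have "c *s a = - (c *s a)" by simp
      then have "c *s a = 0" by (simp only: eq_uminus_self_iff)
      then show ?thesis using cd by auto
    qed
    obtain j where j: "M j *v b = - b" using neg[OF b(1) b_eig] by blast
    \<comment> \<open>Such an element acts as -1 on the fixed plane of \<open>g\<close>, yet by
      \<open>meet\<close> it fixes a nonzero vector there.\<close>
    have no_both: False if "M n *v a = - a" "M n *v b = - b" for n
    proof -
      obtain x where x: "x \<noteq> 0" "M g *v x = x" "M n *v x = x" using meet by blast
      then obtain c d where "x = c *s a + d *s b" using gspan a b ba by blast
      then have "M n *v x = - x" by (simp add: mvmult_lin that)
      then show False using x by (simp add: eq_uminus_self_iff)
    qed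
    from pm[OF a(1) a_eig] consider "M j *v a = a" | "M j *v a = - a" by blast
    then show False
    proof cases
      case 1
      have "M (j + k) *v a = - a" "M (j + k) *v b = - b"
        unfolding homv by (simp_all add: 1 k b j negv)
      then show False by (rule no_both)
    next
      case 2 then show False using no_both j by blast
    qed
  qed
  then obtain g v1 where v1: "v1 \<noteq> 0" "M g *v v1 = v1" "\<And>x. M g *v x = x \<Longrightarrow> \<exists>c. x = c *s v1"
    by blast
  have eig1: "\<exists>c. M l *v v1 = c *s v1" for l
    using v1 comm by metis
  obtain k where k: "M k *v v1 = - v1" using neg[OF v1(1) eig1] by blast
  obtain v2 where v2: "v2 \<noteq> 0" "M k *v v2 = v2" using fixes_some by blast
  have v21: "\<And>c. v2 \<noteq> c *s v1" using not_mult k v2 by blast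
  \<comment> \<open>Otherwise \<open>k\<close> fixes a plane and negates \<open>v1\<close>. Split a
    fixed vector \<open>z\<close> of \<open>g + k\<close> as \<open>y + a *s v1\<close> with
    \<open>y\<close> in that plane. Then \<open>g\<close> sends \<open>y\<close> to
    \<open>y + (2 * a) *s v1\<close>, which \<open>k\<close> must fix, so \<open>a = 0\<close>. Now
    \<open>g\<close> fixes \<open>y\<close>, making it a multiple of \<open>v1\<close>, hence
    zero.\<close>
  have line2: "\<exists>c. x = c *s v2" if x: "M k *v x = x" for x
  proof (rule ccontr)
    assume *: "\<nexists>c. x = c *s v2"
    have "v1 \<noteq> c *s v2 + d *s x" for c d
    proof
      assume "v1 = c *s v2 + d *s x"
      then have "M k *v v1 = v1" by (simp add: mvmult_lin x v2)
      then show False using k v1 by (simp add: eq_uminus_self_iff)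
    qed
    then have ind: "indep3 v2 x v1" using * v2 by (intro indep3I) auto
    obtain z where z: "z \<noteq> 0" "M (g + k) *v z = z" using fixes_some by blast
    obtain b c a where abc: "z = b *s v2 + c *s x + a *s v1" using ind by (rule indep3_span)
    define y where "y = b *s v2 + c *s x"
    have ky: "M k *v y = y" by (simp add: y_def mvmult_lin v2 x)
    have zy: "z = y + a *s v1" using abc y_def by simp
    have "M k *v z = y - a *s v1" unfolding zy
      by (simp add: matrix_vector_right_distrib mvmult_lin ky k)
    then have "M g *v y - a *s v1 = y + a *s v1"
      using z(2) by (simp add: homv zy matrix_vector_mult_diff_distrib mvmult_lin v1)
    then have gy: "M g *v y = y + (2 * a) *s v1"
      by (simp add: vec_eq_iff algebra_simps)
    have "M k *v (M g *v y) = M g *v y" using comm ky by metis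
    then have "(2 * a) *s v1 = - ((2 * a) *s v1)"
      unfolding gy by (simp add: matrix_vector_right_distrib mvmult_lin k ky)
    then have a0: "(2 * a) *s v1 = 0" by (simp only: eq_uminus_self_iff)
    then obtain e where "y = e *s v1" using v1(3)[of y] gy by auto
    then have "M k *v y = - y" by (simp add: mvmult_lin k)
    then have "y = 0" using ky by (simp add: eq_uminus_self_iff)
    then show False using a0 z v1 zy by simp
  qed
  have eig2: "\<exists>c. M l *v v2 = c *s v2" for l
    using line2 v2 comm by metis
  obtain j where j: "M j *v v2 = - v2" using neg[OF v2(1) eig2] by blast
  \<comment> \<open>If \<open>j\<close> fixes \<open>v1\<close>, then \<open>j + k\<close> negates
    both vectors; otherwise \<open>j\<close> itself does.\<close>
  obtain m where m: "M m *v v1 = - v1" "M m *v v2 = - v2"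
  proof -
    from pm[OF v1(1) eig1] consider "M j *v v1 = v1" | "M j *v v1 = - v1" by blast
    then show ?thesis
    proof cases
      case 1
      then have "M (j + k) *v v1 = - v1" "M (j + k) *v v2 = - v2"
        unfolding homv by (simp_all add: k v2 j negv)
      then show ?thesis by (rule that)
    qed (use j that in blast)
  qed
  obtain v3 where v3: "v3 \<noteq> 0" "M m *v v3 = v3" using fixes_some by blast
  have "v3 \<noteq> c *s v1 + d *s v2" for c d
  proof
    assume "v3 = c *s v1 + d *s v2"
    then have "M m *v v3 = - v3" by (simp add: mvmult_lin m)
    then show False using v3 by (simp add: eq_uminus_self_iff)
  qed
  then have ind: "indep3 v1 v2 v3" using v1 v21 by (intro indep3I) auto
  have line3: "\<exists>c. x = c *s v3" if x: "M m *v x = x" for x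
  proof -
    obtain a b c where abc: "x = a *s v1 + b *s v2 + c *s v3" using ind by (rule indep3_span)
    define y where "y = a *s v1 + b *s v2"
    have "M m *v y = - y" by (simp add: y_def mvmult_lin m)
    moreover have "x = y + c *s v3" using abc y_def by simp
    ultimately have "- y = y" using x by (simp add: matrix_vector_right_distrib mvmult_lin v3)
    then have "y = 0" by (simp only: eq_uminus_self_iff)
    then show ?thesis using \<open>x = y + c *s v3\<close> by auto
  qed
  have eig3: "\<exists>c. M l *v v3 = c *s v3" for l
    using line3 v3 comm by metis
  obtain c1 c2 c3 where c: "\<And>l. M l *v v1 = c1 l *s v1" "\<And>l. M l *v v2 = c2 l *s v2" "\<And>l. M l *v v3 = c3 l *s v3"
    using char[OF eig1] char[OF eig2] char[OF eig3] by blast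
  have val: "c = d" if "c *s v = d *s v" "v \<noteq> 0" for c d and v :: "rat^3"
    using that by (simp add: vec_eq_iff) metis
  have "M k *v v3 \<noteq> v3"
  proof
    assume "M k *v v3 = v3"
    then obtain e where "v3 = e *s v2" using line2 by blast
    then have "M m *v v3 = - v3" by (simp add: mvmult_lin m)
    then show False using v3 by (simp add: eq_uminus_self_iff)
  qed
  then have "M k *v v3 = - v3" using pm[OF v3(1) eig3] by blast
  then show ?thesis
    using ind c k v2 m v3 val[of "c1 k" v1 "-1"] val[of "c2 k" v2 1] val[of "c3 k" v3 "-1"]
      val[of "c1 m" v1 "-1"] val[of "c2 m" v2 "-1"] val[of "c3 m" v3 1] v1(1)
    by (intro that[of v1 v2 v3 c1 c2 c3 k m]) (auto simp: c)
qed

subsection \<open>Integral, rational and real vectors\<close>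

abbreviation ratmat :: "int^3^3 \<Rightarrow> rat^3^3" where "ratmat \<equiv> map_matrix of_int"
abbreviation realmat :: "int^3^3 \<Rightarrow> real^3^3" where "realmat \<equiv> map_matrix of_int"

definition rvec :: "rat^3 \<Rightarrow> real^3" where "rvec x = (\<chi> i. of_rat (x$i))"

lemma map_matrix_of_int_mult:
  "map_matrix of_int (M ** N) = (map_matrix of_int M ** map_matrix of_int N :: 'a::ring_1^'n^'m)"
  by (simp add: map_matrix_def matrix_matrix_mult_def vec_eq_iff)

lemma map_matrix_of_int_one: "map_matrix of_int (mat 1) = (mat 1 :: 'a::ring_1^'n^'n)"
  by (simp add: map_matrix_def mat_def vec_eq_iff)

lemma map_matrix_of_int_transpose:
  "map_matrix of_int (transpose M) = transpose (map_matrix of_int M)"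
  by (simp add: map_matrix_def transpose_def vec_eq_iff)

lemma realmat_intvec: "realmat M *v real_of_intvec k = real_of_intvec (M *v k)"
  by (simp add: map_matrix_def matrix_vector_mult_def real_of_intvec_def vec_eq_iff)

lemma rvec_simps:
  "rvec (x + y) = rvec x + rvec y" "rvec (c *s x) = of_rat c *\<^sub>R rvec x"
  by (simp_all add: rvec_def vec_eq_iff of_rat_add of_rat_mult)

lemma of_rat_sum: "of_rat (sum f A) = (\<Sum>x\<in>A. of_rat (f x))"
  by (induction A rule: infinite_finite_induct) (simp_all add: of_rat_add)

lemma rvec_mult: "rvec (ratmat M *v x) = realmat M *v rvec x"
  by (simp add: rvec_def map_matrix_def matrix_vector_mult_def vec_eq_iff of_rat_sum of_rat_mult)

lemma rvec_intvec: "rvec (\<chi> i. of_int (k$i)) = real_of_intvec k"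
  by (simp add: rvec_def real_of_intvec_def vec_eq_iff)

text \<open>Independence is nonvanishing of a determinant, which is insensitive to extending the
  field.\<close>

lemma indep3_rvec:
  assumes "indep3 u v w"
  shows "indep3 (rvec u) (rvec v) (rvec w)"
proof -
  have "det (columns3 u v w) \<noteq> 0"
    using assms by (simp add: invertible_columns3[symmetric] invertible_det_nz)
  moreover have "det (columns3 (rvec u) (rvec v) (rvec w)) = of_rat (det (columns3 u v w))"
    by (simp add: det_3 columns3_def rvec_def of_rat_add of_rat_mult of_rat_diff)
  ultimately show ?thesis
    by (simp add: invertible_columns3[symmetric] invertible_det_nz)
qed

text \<open>By uniqueness of coordinates, the real expansion of a lattice vector is its rational
  one. Freeness proofs use this to turn a fixed point modulo the lattice into rationality of
  numbers.\<close>

lemma rational_coords: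
  assumes "indep3 u v w"
    and "x *\<^sub>R rvec u + y *\<^sub>R rvec v + z *\<^sub>R rvec w = real_of_intvec k"
  shows "x \<in> \<rat>" "y \<in> \<rat>" "z \<in> \<rat>"
proof -
  obtain a b c where "(\<chi> i. of_int (k$i)) = a *s u + b *s v + c *s w"
    using assms(1) by (rule indep3_span)
  then have "real_of_intvec k = of_rat a *\<^sub>R rvec u + of_rat b *\<^sub>R rvec v + of_rat c *\<^sub>R rvec w"
    by (simp add: rvec_simps flip: rvec_intvec)
  then have "x = of_rat a" "y = of_rat b" "z = of_rat c"
    using indep3_coords_eq[OF indep3_rvec[OF assms(1)], of x y z "of_rat a" "of_rat b" "of_rat c"] assms(2)
    by (simp_all add: scalar_mult_eq_scaleR)
  then show "x \<in> \<rat>" "y \<in> \<rat>" "z \<in> \<rat>" by simp_all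
qed

section \<open>Rational fixed vectors, primitive vectors and integrality of eigenvalues\<close>

lemma fixed_vector_iff_det: "(\<exists>v. v \<noteq> 0 \<and> N *v v = v) \<longleftrightarrow> det (N - mat 1) = 0" for N :: "'a::field^'n^'n"
proof -
  have "N *v v = v \<longleftrightarrow> (N - mat 1) *v v = 0" for v
    by (simp add: matrix_vector_mult_diff_rdistrib)
  then show ?thesis
    using invertible_det_nz[of "N - mat 1"]
    unfolding invertible_left_inverse matrix_left_invertible_ker by auto
qed

lemma det_of_int: "det (map_matrix of_int M) = (of_int (det M) :: 'a::comm_ring_1)" for M :: "int^3^3"
  by (simp add: det_3 map_matrix_def)

lemma has_eigenvalue_one_iff_det: "has_eigenvalue_one M \<longleftrightarrow> det (M - mat 1) = 0"
proof -
  have "has_eigenvalue_one M \<longleftrightarrow> (\<exists>v. v \<noteq> 0 \<and> realmat M *v v = v)"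
    unfolding has_eigenvalue_one_def map_matrix_def ..
  also have "\<dots> \<longleftrightarrow> det (realmat M - mat 1) = 0" by (rule fixed_vector_iff_det)
  also have "realmat M - mat 1 = realmat (M - mat 1)"
    by (simp add: map_matrix_def vec_eq_iff mat_def)
  finally show ?thesis by (simp add: det_of_int)
qed

text \<open>Eigenvalue one amounts to vanishing of an integer determinant, the same over both
  fields, so a real fixed vector yields a rational one.\<close>

lemma has_eigenvalue_one_rat: "has_eigenvalue_one M \<longleftrightarrow> (\<exists>v. v \<noteq> 0 \<and> ratmat M *v v = v)"
proof -
  have "ratmat M - mat 1 = ratmat (M - mat 1)"
    by (simp add: map_matrix_def vec_eq_iff mat_def)
  then show ?thesis by (simp add: has_eigenvalue_one_iff_det fixed_vector_iff_det det_of_int)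
qed

text \<open>Clear denominators by \<open>D\<close> and divide by the gcd. The vector
  \<open>u\<close> collects Bezout coefficients and certifies that \<open>k\<close> is
  primitive.\<close>

lemma primitive_multiple:
  fixes v :: "rat^3"
  assumes "v \<noteq> 0"
  obtains r and k u :: "int^3" where "r \<noteq> 0" "r *s v = (\<chi> i. of_int (k$i))" "u$1 * k$1 + u$2 * k$2 + u$3 * k$3 = (1::int)"
proof -
  define n where "n i = fst (quotient_of (v$i))" for i
  define d where "d i = snd (quotient_of (v$i))" for i
  have d: "d i > 0" for i unfolding d_def using quotient_of_denom_pos' by blast
  have v: "v$i = of_int (n i) / of_int (d i)" for i
    unfolding n_def d_def by (simp add: quotient_of_div)
  define m :: "int^3" where "m = vector [n 1 * d 2 * d 3, n 2 * d 1 * d 3, n 3 * d 1 * d 2]"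
  define D where "D = d 1 * d 2 * d 3"
  have D: "D > 0" using d by (simp add: D_def)
  have d': "d i \<noteq> 0" for i using d[of i] by simp
  have m: "rat_of_int D *s v = (\<chi> i. of_int (m$i))"
    using d'[of 1] d'[of 2] d'[of 3] by (simp add: vec_eq_iff forall_3 m_def D_def v)
  define g where "g = gcd (m$1) (gcd (m$2) (m$3))"
  have "m \<noteq> 0"
  proof
    assume "m = 0"
    then have "rat_of_int D *s v = 0" using m by (simp add: vec_eq_iff)
    then show False using assms D by simp
  qed
  then have g: "g \<noteq> 0" by (auto simp: g_def vec_eq_iff forall_3)
  obtain a b where ab: "a * m$2 + b * m$3 = gcd (m$2) (m$3)" using bezout_int by blast
  obtain e f where ef: "e * m$1 + f * gcd (m$2) (m$3) = g" unfolding g_def using bezout_int by blast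
  have dvd: "g dvd m$i" for i using exhaust_3[of i] by (auto simp: g_def)
     (metis dvd_trans gcd_dvd1 gcd_dvd2)+
  define k :: "int^3" where "k = (\<chi> i. m$i div g)"
  have mk: "m$i = g * k$i" for i using dvd by (simp add: k_def)
  show thesis
  proof
    show "rat_of_int D / of_int g \<noteq> 0" using D g by simp
    show "(rat_of_int D / of_int g) *s v = (\<chi> i. of_int (k$i))"
      using m g by (simp add: vec_eq_iff mk field_simps)
    have "g * (e * k$1 + f * a * k$2 + f * b * k$3) = g * 1"
      using ef[folded ab] unfolding mk by (simp only: algebra_simps)
    then show "(vector [e, f * a, f * b] :: int^3)$1 * k$1 + (vector [e, f * a, f * b] :: int^3)$2 * k$2
      + (vector [e, f * a, f * b] :: int^3)$3 * k$3 = 1"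
      using g by (simp only: mult_cancel_left vector_3) simp
  qed
qed

text \<open>Pairing the eigenvalue equation of a primitive eigenvector with its Bezout vector shows
  that \<open>c\<close> is an integer. The same argument for the inverse matrix makes
  \<open>1/c\<close> an integer.\<close>

lemma invertible_int_eigenvalue:
  assumes "invertible M" "v \<noteq> 0" "ratmat M *v v = c *s v"
  shows "c = 1 \<or> c = -1"
proof -
  obtain r and k u :: "int^3" where rk: "r \<noteq> 0" "r *s v = (\<chi> i. of_int (k$i))" "u$1 * k$1 + u$2 * k$2 + u$3 * k$3 = (1::int)"
    using primitive_multiple[OF assms(2)] by blast
  define K :: "rat^3" where "K = (\<chi> i. of_int (k$i))"
  have int: "\<exists>n. d = of_int n" if "ratmat N *v K = d *s K" for N d
  proof -
    have "d * of_int (k$i) = of_int ((N *v k)$i)" for i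
    proof -
      have "(d *s K)$i = (ratmat N *v K)$i" using that by simp
      then show ?thesis by (simp add: K_def map_matrix_def matrix_vector_mult_def)
    qed
    then have "d * of_int (u$1 * k$1 + u$2 * k$2 + u$3 * k$3)
       = of_int (u$1 * (N *v k)$1 + u$2 * (N *v k)$2 + u$3 * (N *v k)$3)"
      by (simp add: distrib_left mult.left_commute[of d])
    then show ?thesis unfolding rk(3) by (metis mult.right_neutral of_int_1)
  qed
  have MK: "ratmat M *v K = c *s K"
    unfolding K_def rk(2)[symmetric] by (simp add: mvmult_lin assms(3) vec_eq_iff)
  then obtain n where n: "c = of_int n" using int by blast
  obtain N where "N ** M = mat 1" using assms(1) unfolding invertible_def by blast
  then have "ratmat N ** ratmat M = mat 1" by (metis map_matrix_of_int_mult map_matrix_of_int_one)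
  then have NK: "K = c *s (ratmat N *v K)"
    using MK by (metis matrix_vector_mul_assoc matrix_vector_mul_lid mvmult_lin(2))
  have "K \<noteq> 0" using rk assms(2) by (simp add: K_def flip: rk(2))
  then have "c \<noteq> 0" using NK by auto
  then have "ratmat N *v K = (1/c) *s K" using NK by (metis (no_types) divide_self_if vector_smult_assoc vector_smult_lid times_divide_eq_left mult_1)
  then obtain m where "1/c = of_int m" using int by blast
  then have "of_int (n * m) = (1::rat)" using n \<open>c \<noteq> 0\<close> by (simp add: field_simps)
  then have "n * m = 1" by (simp only: of_int_eq_1_iff)
  then show ?thesis using n by (auto simp: zmult_eq_1_iff)
qed

subsection \<open>Affine actions\<close>

lemma affine_action:
  fixes A :: "int^'p::finite \<Rightarrow> int^3^3"
  assumes hom: "\<And>l m. A (l + m) = A l ** A m" and one: "A 0 = mat 1"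
    and cocycle: "\<And>l m. s (l + m) = realmat (A l) *v s m + s l"
    and free: "\<And>l x k. l \<noteq> 0 \<Longrightarrow> realmat (A l) *v x + s l \<noteq> x + real_of_intvec k"
  shows "\<exists>\<phi> :: int^'p \<Rightarrow> torus \<Rightarrow> torus.
           real_analytic_action \<phi> \<and> free_action \<phi> \<and> (\<forall>l. H1_induced (\<phi> l) = A l)"
proof (rule action_from_lifts[where F = "\<lambda>l x. realmat (A l) *v x + s l"])
  show "real_analytic (\<lambda>x. realmat (A l) *v x + s l)" for l
    using real_analytic_affine_trig[of "realmat (A l)" "s l" 0 0 0] by simp
  show "continuous_on UNIV (\<lambda>x. realmat (A l) *v x + s l)" for l
    by (intro continuous_intros matrix_vector_mult_linear_continuous_on)
  show "realmat (A 0) *v x + s 0 = x" for x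
    using cocycle[of 0 0] by (simp add: one map_matrix_of_int_one)
  show "\<exists>k. realmat (A (l + m)) *v x + s (l + m) = realmat (A l) *v (realmat (A m) *v x + s m) + s l + real_of_intvec k"
    for l m x
    by (rule exI[of _ 0], simp add: real_of_intvec_def vec_eq_iff,
        simp add: hom cocycle map_matrix_of_int_mult matrix_vector_right_distrib matrix_vector_mul_assoc)
qed (use free in \<open>simp_all add: matrix_vector_right_distrib realmat_intvec\<close>)

lemma rational_linear_intvec:
  assumes "\<And>i. w i \<in> \<rat>"
  shows "(\<Sum>i\<in>UNIV. w i * real_of_intvec k $ i) \<in> \<rat>"
  using assms by (auto simp: real_of_intvec_def intro!: Rats_sum Rats_mult)

text \<open>The three conditions in \<open>free\<close> concern the coordinates of the displacement
  of \<open>x\<close>, which at a fixed point of the torus map is a lattice vector. The coordinate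
  of \<open>x\<close> along \<open>v\<close> drops out because \<open>v\<close> is fixed.\<close>

lemma flag_affine_action:
  fixes A :: "int^'p::finite \<Rightarrow> int^3^3" and a b c e :: "int^'p \<Rightarrow> rat"
    and s1 s2 s3 :: "int^'p \<Rightarrow> real"
  assumes hom: "\<And>l m. A (l + m) = A l ** A m" and one: "A 0 = mat 1"
    and ind: "indep3 v y z"
    and Av: "\<And>l. ratmat (A l) *v v = v"
    and Ay: "\<And>l. ratmat (A l) *v y = e l *s y + a l *s v"
    and Az: "\<And>l. ratmat (A l) *v z = z + b l *s y + c l *s v"
    and s3: "\<And>l m. s3 (l + m) = s3 l + s3 m"
    and s2: "\<And>l m. s2 (l + m) = s2 l + of_rat (e l) * s2 m + of_rat (b l) * s3 m"
    and s1: "\<And>l m. s1 (l + m) = s1 l + s1 m + of_rat (a l) * s2 m + of_rat (c l) * s3 m"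
    and free: "\<And>l x2 x3. of_rat (a l) * x2 + of_rat (c l) * x3 + s1 l \<in> \<rat> \<Longrightarrow>
        (of_rat (e l) - 1) * x2 + of_rat (b l) * x3 + s2 l \<in> \<rat> \<Longrightarrow> s3 l \<in> \<rat> \<Longrightarrow> l = 0"
  shows "\<exists>\<phi> :: int^'p \<Rightarrow> torus \<Rightarrow> torus.
           real_analytic_action \<phi> \<and> free_action \<phi> \<and> (\<forall>l. H1_induced (\<phi> l) = A l)"
proof (rule affine_action[OF hom one, where s = "\<lambda>l. s1 l *\<^sub>R rvec v + s2 l *\<^sub>R rvec y + s3 l *\<^sub>R rvec z"])
  have A_coords: "realmat (A l) *v (x1 *\<^sub>R rvec v + x2 *\<^sub>R rvec y + x3 *\<^sub>R rvec z) =
      (x1 + of_rat (a l) * x2 + of_rat (c l) * x3) *\<^sub>R rvec v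
      + (of_rat (e l) * x2 + of_rat (b l) * x3) *\<^sub>R rvec y + x3 *\<^sub>R rvec z" for l x1 x2 x3
    by (simp add: matrix_vector_right_distrib matrix_vector_mult_scaleR Av Ay Az rvec_simps
        algebra_simps flip: rvec_mult)
  show "s1 (l + m) *\<^sub>R rvec v + s2 (l + m) *\<^sub>R rvec y + s3 (l + m) *\<^sub>R rvec z =
      realmat (A l) *v (s1 m *\<^sub>R rvec v + s2 m *\<^sub>R rvec y + s3 m *\<^sub>R rvec z) +
      (s1 l *\<^sub>R rvec v + s2 l *\<^sub>R rvec y + s3 l *\<^sub>R rvec z)" for l m
    unfolding A_coords s1 s2 s3 by (simp add: algebra_simps)
  fix l :: "int^'p" and x :: "real^3" and k
  assume l: "l \<noteq> 0"
  show "realmat (A l) *v x + (s1 l *\<^sub>R rvec v + s2 l *\<^sub>R rvec y + s3 l *\<^sub>R rvec z) \<noteq> x + real_of_intvec k"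
  proof
    obtain x1 x2 x3 where x: "x = x1 *\<^sub>R rvec v + x2 *\<^sub>R rvec y + x3 *\<^sub>R rvec z"
      using indep3_span[OF indep3_rvec[OF ind], of x] by (auto simp: scalar_mult_eq_scaleR)
    assume "realmat (A l) *v x + (s1 l *\<^sub>R rvec v + s2 l *\<^sub>R rvec y + s3 l *\<^sub>R rvec z) = x + real_of_intvec k"
    then have "(of_rat (a l) * x2 + of_rat (c l) * x3 + s1 l) *\<^sub>R rvec v
      + ((of_rat (e l) - 1) * x2 + of_rat (b l) * x3 + s2 l) *\<^sub>R rvec y + s3 l *\<^sub>R rvec z = real_of_intvec k"
      unfolding x A_coords by (simp add: algebra_simps)
    from rational_coords[OF ind this] free l show False by blast
  qed
qed

text \<open>Pairing a fixed-point equation with the invariant covector \<open>w\<close> cancels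
  \<open>x\<close>; what remains says that a nonzero rational multiple of \<open>\<tau> l\<close> is
  rational.\<close>

lemma transverse_affine_action:
  fixes A :: "int^'p::finite \<Rightarrow> int^3^3" and v w :: "rat^3"
  assumes hom: "\<And>l m. A (l + m) = A l ** A m" and one: "A 0 = mat 1"
    and Av: "\<And>l. ratmat (A l) *v v = v"
    and wA: "\<And>l. w v* ratmat (A l) = w"
    and wv: "(\<Sum>i\<in>UNIV. w$i * v$i) \<noteq> 0"
  shows "\<exists>\<phi> :: int^'p \<Rightarrow> torus \<Rightarrow> torus.
           real_analytic_action \<phi> \<and> free_action \<phi> \<and> (\<forall>l. H1_induced (\<phi> l) = A l)"
proof -
  obtain \<kappa> :: real and \<tau> :: "int^'p \<Rightarrow> real" where \<tau>: "\<And>l m. \<tau> (l + m) = \<tau> l + \<tau> m"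
    and gen: "\<And>r q l. r \<in> \<rat> \<Longrightarrow> q \<in> \<rat> \<Longrightarrow> \<kappa> * r + q * \<tau> l \<in> \<rat> \<Longrightarrow> r = 0 \<and> (q = 0 \<or> l = 0)"
    using exists_generic_frequencies by metis
  have dual: "rvec w \<bullet> (realmat (A l) *v x) = rvec w \<bullet> x" for l x
  proof -
    have "rvec w v* realmat (A l) = rvec w"
      using wA[of l] rvec_mult[of "transpose (A l)" w] by (simp add: map_matrix_of_int_transpose)
    then show ?thesis by (simp flip: dot_lmul_matrix)
  qed
  show ?thesis
  proof (rule affine_action[OF hom one, where s = "\<lambda>l. \<tau> l *\<^sub>R rvec v"])
    show "\<tau> (l + m) *\<^sub>R rvec v = realmat (A l) *v (\<tau> m *\<^sub>R rvec v) + \<tau> l *\<^sub>R rvec v" for l m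
      by (simp add: \<tau> matrix_vector_mult_scaleR Av algebra_simps flip: rvec_mult)
    fix l :: "int^'p" and x :: "real^3" and k
    assume l: "l \<noteq> 0"
    show "realmat (A l) *v x + \<tau> l *\<^sub>R rvec v \<noteq> x + real_of_intvec k"
    proof
      assume "realmat (A l) *v x + \<tau> l *\<^sub>R rvec v = x + real_of_intvec k"
      then have "rvec w \<bullet> (realmat (A l) *v x + \<tau> l *\<^sub>R rvec v) = rvec w \<bullet> (x + real_of_intvec k)" by simp
      then have "(rvec w \<bullet> rvec v) * \<tau> l = rvec w \<bullet> real_of_intvec k"
        by (simp add: inner_add_right dual mult.commute)
      also have "\<dots> = (\<Sum>i\<in>UNIV. rvec w $ i * real_of_intvec k $ i)"
        by (simp add: inner_vec_def)
      finally have "(rvec w \<bullet> rvec v) * \<tau> l = (\<Sum>i\<in>UNIV. rvec w $ i * real_of_intvec k $ i)" .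
      moreover have "\<dots> \<in> \<rat>" by (rule rational_linear_intvec) (simp add: rvec_def)
      moreover have "rvec w \<bullet> rvec v = of_rat (\<Sum>i\<in>UNIV. w$i * v$i)"
        by (simp add: inner_vec_def rvec_def of_rat_sum of_rat_mult)
      ultimately show False using gen[of 0 "rvec w \<bullet> rvec v" l] l wv by auto
    qed
  qed
qed

text \<open>The invariant functional \<open>w\<close> makes its kernel, which contains
  \<open>v\<close>, an invariant plane with trivial action on the quotient. If \<open>e\<close>
  takes the value -1, commuting with that element splits off an eigenline.\<close>

theorem fixed_flag_structure:
  fixes M :: "'g::ab_group_add \<Rightarrow> rat^3^3"
  assumes hom: "\<And>l m. M (l + m) = M l ** M m"
    and det: "\<And>l. det (M l) = 1 \<or> det (M l) = -1"
    and v: "v \<noteq> 0" "\<And>l. M l *v v = v"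
    and w: "w \<noteq> 0" "\<And>l. w v* M l = w"
    and wv: "(\<Sum>i\<in>UNIV. w$i * v$i) = 0"
  obtains y z a b c e where "indep3 v y z"
    "\<And>l. M l *v y = e l *s y + a l *s v"
    "\<And>l. M l *v z = z + b l *s y + c l *s v"
    "(\<forall>l. e l = 1) \<or> (\<forall>l. a l = 0 \<and> b l = 0)"
proof -
  define f where "f x = (\<Sum>i\<in>UNIV. w$i * x$i)" for x
  have f_add: "f (x + y) = f x + f y" and f_scale: "f (c *s x) = c * f x" for x y c
    by (simp_all add: f_def sum.distrib distrib_left sum_distrib_left mult.left_commute)
  have f_M: "f (M l *v x) = f x" for l x
  proof -
    have "f (M l *v x) = (\<Sum>i\<in>UNIV. (w v* M l)$i * x$i)"
      unfolding f_def matrix_vector_mult_def vector_matrix_mult_def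
      by (simp add: sum_3 algebra_simps)
    then show ?thesis by (simp add: w f_def)
  qed
  have fv: "f v = 0" using wv by (simp add: f_def)
  obtain i where "w$i \<noteq> 0" using w by (auto simp: vec_eq_iff)
  then have "f (axis i (1 / w$i)) = 1" by (simp add: f_def axis_def if_distrib cong: if_cong)
  then obtain t where t: "f t = 1" by blast
  have "vec.span {v, t} \<noteq> (UNIV :: (rat^3) set)"
  proof
    assume *: "vec.span {v, t} = (UNIV :: (rat^3) set)"
    have "vec.dim (vec.span {v, t}) \<le> card {v, t}" by (rule vec.dim_le_card) auto
    also have "\<dots> \<le> 2" by (simp add: card_insert_if)
    finally show False unfolding * vec_dim_card by simp
  qed
  then obtain s where s: "s \<notin> vec.span {v, t}" by blast
  define y where "y = s + (- f s) *s t"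
  have fy: "f y = 0" unfolding y_def f_add f_scale t by simp
  have "y \<noteq> c *s v" for c
  proof
    assume "y = c *s v"
    then have "s = c *s v + f s *s t" by (simp add: y_def vec_eq_iff algebra_simps)
    then have "s \<in> vec.span {v, t}"
      by (metis insertI1 insertI2 vec.span_add vec.span_base vec.span_scale)
    with s show False by simp
  qed
  moreover have "t \<noteq> c *s v + d *s y" for c d
    using t by (auto simp: f_add f_scale fv fy)
  ultimately have ind: "indep3 v y t" using v by (intro indep3I) auto
  have "\<exists>a e. M l *v y = e *s y + a *s v" for l
  proof -
    obtain a b c where *: "M l *v y = a *s v + b *s y + c *s t" using ind by (rule indep3_span)
    then have "c = 0" using f_M[of l y] by (simp add: f_add f_scale fv fy t)
    then show ?thesis using * by (auto simp: add.commute)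
  qed
  then obtain a e where My: "\<And>l. M l *v y = e l *s y + a l *s v" by metis
  have "\<exists>b c. M l *v t = t + b *s y + c *s v" for l
  proof -
    obtain a b c where *: "M l *v t = a *s v + b *s y + c *s t" using ind by (rule indep3_span)
    then have "c = 1" using f_M[of l t] by (simp add: f_add f_scale fv fy t)
    then show ?thesis using * by (intro exI[of _ b] exI[of _ a]) (simp add: add_ac)
  qed
  then obtain b c where Mt: "\<And>l. M l *v t = t + b l *s y + c l *s v" by metis
  \<comment> \<open>In the basis \<open>v\<close>, \<open>y\<close>, \<open>t\<close> the matrix is
    triangular with diagonal 1, \<open>e l\<close>, 1, so \<open>e l\<close> is its
    determinant.\<close>
  have e: "e l = 1 \<or> e l = -1" for l
  proof -
    have "det (M l) * det (columns3 v y t) = det (columns3 v (e l *s y + a l *s v) (t + b l *s y + c l *s v))"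
      by (simp add: matrix_mult_columns3 v My Mt flip: det_mul)
    also have "\<dots> = e l * det (columns3 v y t)"
      by (simp add: det_3 columns3_def algebra_simps)
    finally have "det (M l) = e l"
      using ind by (simp add: invertible_columns3[symmetric] invertible_det_nz)
    then show ?thesis using det by metis
  qed
  show thesis
  proof (cases "\<forall>l. e l = 1")
    case True
    then show ?thesis using that[OF ind My Mt] by blast
  next
    case False
    then obtain g where g: "e g = -1" using e by metis
    have comm: "M l *v (M m *v x) = M m *v (M l *v x)" for l m x
      by (metis hom add.commute matrix_vector_mul_assoc)
    \<comment> \<open>Commuting with \<open>g\<close> makes \<open>a\<close>, and below
      \<open>b\<close>, a coboundary of the character \<open>e\<close>, removable by a change of
      basis.\<close>
    have a: "a l = a g / 2 * (1 - e l)" for l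
    proof -
      have "M g *v (M l *v y) = (a g * e l + a l) *s v + (- e l) *s y + 0 *s t"
        unfolding My Mt matrix_vector_right_distrib mvmult_lin(2) v(2) g by (simp add: vec_eq_iff algebra_simps)
      moreover have "M l *v (M g *v y) = (- a l + a g) *s v + (- e l) *s y + 0 *s t"
        unfolding My Mt matrix_vector_right_distrib mvmult_lin(2) v(2) g by (simp add: vec_eq_iff algebra_simps)
      ultimately have "a g * e l + a l = - a l + a g"
        using comm[of g l y] indep3_coords_eq(1)[OF ind] by metis
      then show ?thesis by (simp add: algebra_simps)
    qed
    have b: "b l = b g / 2 * (1 - e l)" for l
    proof -
      have "M g *v (M l *v t) = (c g + b l * a g + c l) *s v + (b g - b l) *s y + 1 *s t"
        unfolding My Mt matrix_vector_right_distrib mvmult_lin(2) v(2) g by (simp add: vec_eq_iff algebra_simps)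
      moreover have "M l *v (M g *v t) = (c l + b g * a l + c g) *s v + (b l + b g * e l) *s y + 1 *s t"
        unfolding My Mt matrix_vector_right_distrib mvmult_lin(2) v(2) g by (simp add: vec_eq_iff algebra_simps)
      ultimately have "b g - b l = b l + b g * e l"
        using comm[of g l t] indep3_coords_eq(2)[OF ind] by metis
      then show ?thesis by (simp add: algebra_simps)
    qed
    \<comment> \<open>\<open>y'\<close> is the eigenvector of \<open>M g\<close> for -1 in the
      invariant plane; correcting \<open>t\<close> by a multiple of it diagonalises the action
      modulo \<open>v\<close>.\<close>
    define y' where "y' = y + (- a g / 2) *s v"
    define z where "z = t + (b g / 2) *s y'"
    have y: "y = y' + (a g / 2) *s v" by (simp add: y'_def vec_eq_iff)
    have My': "M l *v y' = e l *s y' + 0 *s v" for l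
      unfolding y'_def matrix_vector_right_distrib mvmult_lin(2) v(2) My
      by (simp add: vec_eq_iff a[of l] field_simps)
    have Mz: "M l *v z = z + 0 *s y' + (b l * a g / 2 + c l) *s v" for l
      unfolding z_def matrix_vector_right_distrib mvmult_lin My' Mt
      by (simp add: y) (simp add: vec_eq_iff b[of l] field_simps)
    have "indep3 v y' z"
      unfolding indep3_def
    proof (intro allI impI)
      fix \<alpha> \<beta> \<gamma> assume "\<alpha> *s v + \<beta> *s y' + \<gamma> *s z = 0"
      then have "(\<alpha> - (\<beta> + \<gamma> * b g / 2) * a g / 2) *s v + (\<beta> + \<gamma> * b g / 2) *s y + \<gamma> *s t = 0"
        by (simp add: z_def y'_def vec_eq_iff algebra_simps)
      then show "\<alpha> = 0 \<and> \<beta> = 0 \<and> \<gamma> = 0"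
        using ind unfolding indep3_def by fastforce
    qed
    from that[OF this My' Mz] show ?thesis by blast
  qed
qed

text \<open>The cocycle equations are solved explicitly. The cases are \<open>b\<close> zero,
  \<open>b\<close> nonzero with \<open>a\<close> zero, and \<open>a\<close> a nonzero multiple of
  \<open>b\<close>; the \<kappa> parts then have degree two, one and three in the matrix
  entries.\<close>

theorem flag_action:
  fixes A :: "int^'p::finite \<Rightarrow> int^3^3" and a b c e :: "int^'p \<Rightarrow> rat"
  assumes hom: "\<And>l m. A (l + m) = A l ** A m" and one: "A 0 = mat 1"
    and ind: "indep3 v y z"
    and Av: "\<And>l. ratmat (A l) *v v = v"
    and Ay: "\<And>l. ratmat (A l) *v y = e l *s y + a l *s v"
    and Az: "\<And>l. ratmat (A l) *v z = z + b l *s y + c l *s v"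
    and split: "(\<forall>l. e l = 1) \<or> (\<forall>l. a l = 0 \<and> b l = 0)"
  shows "\<exists>\<phi> :: int^'p \<Rightarrow> torus \<Rightarrow> torus.
           real_analytic_action \<phi> \<and> free_action \<phi> \<and> (\<forall>l. H1_induced (\<phi> l) = A l)"
proof -
  obtain \<kappa> :: real and \<tau> :: "int^'p \<Rightarrow> real" where \<tau>: "\<And>l m. \<tau> (l + m) = \<tau> l + \<tau> m"
    and gen: "\<And>r q l. r \<in> \<rat> \<Longrightarrow> q \<in> \<rat> \<Longrightarrow> \<kappa> * r + q * \<tau> l \<in> \<rat> \<Longrightarrow> r = 0 \<and> (q = 0 \<or> l = 0)"
    using exists_generic_frequencies by metis
  have gen\<kappa>: "r = 0" if "\<kappa> * of_rat r \<in> \<rat>" for r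
    using gen[of "of_rat r" 0 0] that by simp
  have gen\<tau>: "l = 0" if "\<tau> l \<in> \<rat>" for l
    using gen[of 0 1 l] that by simp
  have homv: "ratmat (A (l + m)) *v x = ratmat (A l) *v (ratmat (A m) *v x)" for l m x
    by (simp add: hom map_matrix_of_int_mult matrix_vector_mul_assoc)
  have ya: "a (l + m) = e m * a l + a m" for l m
  proof -
    have "a (l + m) *s v + e (l + m) *s y + 0 *s z = (e m * a l + a m) *s v + (e m * e l) *s y + 0 *s z"
      using homv[of l m y]
      by (simp add: Ay Av matrix_vector_right_distrib mvmult_lin vec_eq_iff algebra_simps)
    then show ?thesis by (rule indep3_coords_eq(1)[OF ind])
  qed
  have zbc: "(c l + c m + a l * b m) *s v + (b l + e l * b m) *s y + 1 *s z
      = c (l + m) *s v + b (l + m) *s y + 1 *s z" for l m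
    using homv[of l m z]
    by (simp add: Ay Av Az matrix_vector_right_distrib mvmult_lin vec_eq_iff algebra_simps)
  have zb: "b (l + m) = b l + e l * b m" and zc: "c (l + m) = c l + c m + a l * b m" for l m
    using indep3_coords_eq[OF ind zbc] by metis+
  \<comment> \<open>In each case below \<open>s3\<close>, \<open>s2\<close> and \<open>s1 - \<tau>\<close> are \<open>\<kappa>\<close> times rational cochains, chosen
    so that they detect every \<open>l\<close> with \<open>A l\<close> not semisimple; the remaining \<open>l\<close> are detected by \<open>\<tau>\<close>.\<close>
  note act = flag_affine_action[OF hom one ind Av Ay Az]
  show ?thesis
  proof (cases "\<forall>l. b l = 0")
    case b: True
    \<comment> \<open>Here \<open>c\<close> is additive, and \<open>a\<close> is additive or zero.
      The half squares in \<open>s1\<close> polarize to exactly the required cross terms.\<close>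
    show ?thesis
    proof (rule act[where ?s3.0 = "\<lambda>l. \<kappa> * of_rat (c l)" and ?s2.0 = "\<lambda>l. \<kappa> * of_rat (a l)"
        and ?s1.0 = "\<lambda>l. \<kappa> * ((of_rat (a l))\<^sup>2 + (of_rat (c l))\<^sup>2) / 2 + \<tau> l"], goal_cases)
      case (1 l m) then show ?case by (simp add: zc b of_rat_add algebra_simps)
    next
      case (2 l m) then show ?case
        using split by (auto simp: ya b of_rat_add algebra_simps)
    next
      case (3 l m)
      have "a (l + m) = a l + a m" using split by (auto simp: ya)
      then show ?case
        by (simp add: zc b of_rat_add \<tau> power2_eq_square field_simps)
    next
      case (4 l x2 x3)
      then have c: "c l = 0" using gen\<kappa> by blast
      have a: "a l = 0"
        using split
      proof
        assume "\<forall>l. e l = 1" then show ?thesis using 4 gen\<kappa> by (simp add: b)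
      qed simp
      show ?case using 4 gen\<tau> by (simp add: a c)
    qed
  next
    case False
    then have e: "e l = 1" for l using split by blast
    from False obtain g where g: "b g \<noteq> 0" by blast
    define \<rho> where "\<rho> = a g / b g"
    \<comment> \<open>Symmetry of \<open>c (l + g)\<close> in its two arguments gives
      \<open>a l * b g = a g * b l\<close>.\<close>
    have a: "a l = \<rho> * b l" for l
      using zc[of l g] zc[of g l] g by (simp add: \<rho>_def add.commute field_simps)
    show ?thesis
    proof (cases "\<rho> = 0")
      case True
      show ?thesis
      proof (rule act[where ?s3.0 = "\<lambda>l. 0" and ?s2.0 = "\<lambda>l. - \<kappa> * of_rat (c l)"
          and ?s1.0 = "\<lambda>l. \<kappa> * of_rat (b l) + \<tau> l"], goal_cases)
        case (4 l x2 x3)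
        define b' c' where "b' = real_of_rat (b l)" and "c' = real_of_rat (c l)"
        have "c' * x3 + (\<kappa> * b' + \<tau> l) \<in> \<rat>" "b' * x3 - \<kappa> * c' \<in> \<rat>"
          using 4 by (simp_all add: a True e b'_def c'_def)
        \<comment> \<open>This combination eliminates the unknown \<open>x3\<close>; the signs in
          \<open>s1\<close> and \<open>s2\<close> were chosen so that \<kappa> gets a sum of squares
          as coefficient.\<close>
        then have "b' * (c' * x3 + (\<kappa> * b' + \<tau> l)) - c' * (b' * x3 - \<kappa> * c') \<in> \<rat>"
          unfolding b'_def c'_def by (rule Rats_diff[OF Rats_mult[OF Rats_of_rat] Rats_mult[OF Rats_of_rat]])
        also have "b' * (c' * x3 + (\<kappa> * b' + \<tau> l)) - c' * (b' * x3 - \<kappa> * c')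
            = \<kappa> * (b'\<^sup>2 + c'\<^sup>2) + b' * \<tau> l" by (simp add: algebra_simps power2_eq_square)
        finally have "b'\<^sup>2 + c'\<^sup>2 = 0"
          using gen[of "b'\<^sup>2 + c'\<^sup>2" b' l] by (simp add: b'_def c'_def)
        then have "b l = 0" "c l = 0" by (simp_all add: b'_def c'_def sum_power2_eq_zero_iff)
        then show ?case using 4 gen\<tau> by (simp add: a)
      qed (simp_all add: zb zc a True e \<tau> of_rat_add algebra_simps)
    next
      case \<rho>: False
      define r where "r = real_of_rat \<rho>"
      have r: "r \<noteq> 0" using \<rho> by (simp add: r_def)
      have a': "of_rat (a l) = r * of_rat (b l)" for l by (simp add: a r_def of_rat_mult)
      have c': "of_rat (c (l + m)) = of_rat (c l) + of_rat (c m) + r * of_rat (b l) * (of_rat (b m) :: real)" for l m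
        by (simp add: zc a r_def of_rat_add of_rat_mult)
      have b': "of_rat (b (l + m)) = of_rat (b l) + (of_rat (b m) :: real)" for l m
        by (simp add: zb e of_rat_add)
      \<comment> \<open>Now \<open>c\<close> is additive up to the bilinear term in
        \<open>b\<close>, so \<open>s2\<close> is a multiple of \<open>c\<close>. The cubic term in
        \<open>s1\<close> cancels the excess arising when the product of \<open>b\<close> and
        \<open>c\<close> is expanded at \<open>l + m\<close>.\<close>
      show ?thesis
      proof (rule act[where ?s3.0 = "\<lambda>l. \<kappa> * of_rat (b l)" and ?s2.0 = "\<lambda>l. \<kappa> * of_rat (c l) / r"
          and ?s1.0 = "\<lambda>l. \<kappa> * (of_rat (b l) * of_rat (c l) - r * of_rat (b l) ^ 3 / 3) + \<tau> l"], goal_cases)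
        case (3 l m)
        show ?case unfolding a' b' c' \<tau> using r by (simp add: field_simps power3_eq_cube)
      next
        case (4 l x2 x3)
        then have b: "b l = 0" using gen\<kappa> by blast
        then have "\<kappa> * of_rat (c l) / r * r \<in> \<rat>" using 4 by (intro Rats_mult) (simp_all add: e r_def)
        then have "c l = 0" using gen\<kappa> r by simp
        then show ?case using 4 gen\<tau> by (simp add: a b)
      qed (use r in \<open>simp_all add: a' b' c' e field_simps\<close>)
    qed
  qed
qed

subsection \<open>The Klein four-group case\<close>

text \<open>Take the additive function counting, with multiplicity, the basis vectors sent to -1.
  Unlike the character, it can be halved to build translations.\<close>

lemma sign_character_parity:
  fixes c :: "int^'p::finite \<Rightarrow> rat"
  assumes hom: "\<And>l m. c (l + m) = c l * c m" and pm: "\<And>l. c l = 1 \<or> c l = -1"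
  obtains n :: "int^'p \<Rightarrow> int" where "\<And>l m. n (l + m) = n l + n m"
    "\<And>l. c l = (if even (n l) then 1 else -1)"
proof -
  define d where "d i = (if c (axis i 1) = 1 then 0 else 1 :: int)" for i
  define n where "n l = (\<Sum>i\<in>UNIV. l$i * d i)" for l :: "int^'p"
  have c0: "c 0 = 1" using hom[of 0 0] pm[of 0] by auto
  have double: "c (l + l) = 1" for l using hom[of l l] pm[of l] by auto
  have mult: "c (z *s axis i 1) = (if even (z * d i) then 1 else -1)" for z i
  proof (cases "even z")
    case True
    then obtain q where "z = 2 * q" by blast
    then have "z *s axis i (1::int) = q *s axis i 1 + q *s axis i 1" by (simp add: vec_eq_iff)
    then show ?thesis using double True by simp
  next
    case False
    then obtain q where "z = 2 * q + 1" by (metis oddE)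
    then have "z *s axis i (1::int) = (q *s axis i 1 + q *s axis i 1) + axis i 1"
      by (simp add: vec_eq_iff algebra_simps)
    then have "c (z *s axis i 1) = c (axis i 1)" by (simp only: hom[of "_ + _"] double mult_1)
    then show ?thesis using False pm[of "axis i 1"] by (auto simp: d_def)
  qed
  have "c (\<Sum>i\<in>S. l$i *s axis i 1) = (if even (\<Sum>i\<in>S. l$i * d i) then 1 else -1)"
    if "finite S" for S and l :: "int^'p"
    using that by induction (auto simp: c0 hom mult)
  moreover have "(\<Sum>i\<in>UNIV. l$i *s axis i 1) = l" for l :: "int^'p"
    by (simp add: basis_expansion)
  ultimately have "c l = (if even (n l) then 1 else -1)" for l
    unfolding n_def by (metis finite)
  moreover have "n (l + m) = n l + n m" for l m
    by (simp add: n_def sum.distrib distrib_right)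
  ultimately show ?thesis using that by blast
qed

text \<open>The elements \<open>k\<close>, \<open>m\<close> and \<open>k + m\<close> realise all
  nontrivial sign patterns, which produces lattice vectors along \<open>V1\<close> and
  \<open>V2\<close>. Freeness then rests on the irrationality of the square of
  \<open>\<tau> l\<close>.\<close>

theorem klein_action:
  fixes A :: "int^'p::finite \<Rightarrow> int^3^3" and c1 c2 c3 :: "int^'p \<Rightarrow> rat"
  assumes hom: "\<And>l m. A (l + m) = A l ** A m" and one: "A 0 = mat 1"
    and ind: "indep3 v1 v2 v3"
    and Av: "\<And>l. ratmat (A l) *v v1 = c1 l *s v1" "\<And>l. ratmat (A l) *v v2 = c2 l *s v2"
      "\<And>l. ratmat (A l) *v v3 = c3 l *s v3"
    and pm: "\<And>l. c1 l = 1 \<or> c1 l = -1" "\<And>l. c2 l = 1 \<or> c2 l = -1"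
    and c3: "\<And>l. c3 l = c1 l * c2 l"
    and k: "c1 k = -1" "c2 k = 1" and m: "c1 m = -1" "c2 m = -1"
  shows "\<exists>\<phi> :: int^'p \<Rightarrow> torus \<Rightarrow> torus.
           real_analytic_action \<phi> \<and> free_action \<phi> \<and> (\<forall>l. H1_induced (\<phi> l) = A l)"
proof -
  define V1 V2 V3 where "V1 = rvec v1" and "V2 = rvec v2" and "V3 = rvec v3"
  note V_defs = V1_def V2_def V3_def
  have indV: "indep3 V1 V2 V3" unfolding V_defs by (rule indep3_rvec[OF ind])
  have cval: "c = d" if "c *s v = d *s v" "v \<noteq> 0" for c d and v :: "rat^3"
    using that by (simp add: vec_eq_iff) metis
  note nz = indep3_nonzero(1,2)[OF ind]
  have homv: "ratmat (A (l + m)) *v x = ratmat (A l) *v (ratmat (A m) *v x)" for l m x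
    by (simp add: hom map_matrix_of_int_mult matrix_vector_mul_assoc)
  have c_hom: "c1 (l + m) = c1 l * c1 m" "c2 (l + m) = c2 l * c2 m" for l m
  proof -
    have "c1 (l + m) *s v1 = (c1 l * c1 m) *s v1" "c2 (l + m) *s v2 = (c2 l * c2 m) *s v2"
      using homv[of l m v1] homv[of l m v2]
      by (simp_all add: Av mvmult_lin mult.commute)
    then show "c1 (l + m) = c1 l * c1 m" "c2 (l + m) = c2 l * c2 m"
      using cval nz by blast+
  qed
  obtain n1 :: "int^'p \<Rightarrow> int" where n1: "\<And>l m. n1 (l + m) = n1 l + n1 m" "\<And>l. c1 l = (if even (n1 l) then 1 else -1)"
    using sign_character_parity[of c1] c_hom pm by blast
  obtain n2 :: "int^'p \<Rightarrow> int" where n2: "\<And>l m. n2 (l + m) = n2 l + n2 m" "\<And>l. c2 l = (if even (n2 l) then 1 else -1)"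
    using sign_character_parity[of c2] c_hom pm by blast
  define e1 e2 where "e1 l = (if even (n1 l) then 1 else -1 :: int)"
    and "e2 l = (if even (n2 l) then 1 else -1 :: int)" for l
  have e: "c1 l = of_int (e1 l)" "c2 l = of_int (e2 l)" for l by (simp_all add: e1_def e2_def n1 n2)
  have e_hom: "e1 (l + m) = e1 l * e1 m" "e2 (l + m) = e2 l * e2 m" for l m
    by (simp_all add: e1_def e2_def n1 n2)
  have e_km: "e1 k = -1" "e2 k = 1" "e1 m = -1" "e2 m = -1"
    using k m by (auto simp: e1_def e2_def n1 n2 split: if_splits)
  have e_sq: "e1 l * e1 l = 1" "e2 l * e2 l = 1" for l by (simp_all add: e1_def e2_def)
  have AV: "realmat (A l) *v (x *\<^sub>R V1 + y *\<^sub>R V2 + z *\<^sub>R V3)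
    = (e1 l * x) *\<^sub>R V1 + (e2 l * y) *\<^sub>R V2 + (e1 l * e2 l * z) *\<^sub>R V3" for l and x y z :: real
    unfolding V_defs
    by (simp add: matrix_vector_right_distrib matrix_vector_mult_scaleR Av rvec_simps e c3 of_rat_mult
        mult.commute mult.assoc flip: rvec_mult)
  have expand: "\<exists>a b c. x = a *\<^sub>R V1 + b *\<^sub>R V2 + c *\<^sub>R V3" for x
    using indep3_span[OF indV, of x] by (metis scalar_mult_eq_scaleR)

  obtain Q where Q: "columns3 v1 v2 v3 ** Q = mat 1" "Q ** columns3 v1 v2 v3 = mat 1"
    using ind by (auto simp: invertible_columns3[symmetric] invertible_def)
  \<comment> \<open>The third row of the inverse is the dual covector that kills \<open>v1\<close>
    and \<open>v2\<close> and takes the value 1 at \<open>v3\<close>.\<close>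
  define q where "q = Q $ 3"
  have qv: "(\<Sum>i\<in>UNIV. q$i * (x *s v1 + y *s v2 + z *s v3)$i) = z" for x y z
  proof -
    have "(\<Sum>i\<in>UNIV. q$i * (x *s v1 + y *s v2 + z *s v3)$i)
        = (Q *v (columns3 v1 v2 v3 *v vector [x, y, z])) $ 3"
      unfolding columns3_mult by (simp add: q_def matrix_vector_mult_def[of Q])
    also have "\<dots> = z" using Q by (simp add: matrix_vector_mul_assoc)
    finally show ?thesis .
  qed
  have "q \<noteq> 0" using qv[of 0 0 1] by auto
  then obtain r and w u :: "int^3" where r: "r \<noteq> 0" and w: "r *s q = (\<chi> i. of_int (w$i))"
    and u: "u$1 * w$1 + u$2 * w$2 + u$3 * w$3 = 1" by (rule primitive_multiple)
  define W where "W = real_of_intvec w"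
  have W: "W = of_rat r *\<^sub>R rvec q" unfolding W_def rvec_intvec[symmetric] w[symmetric] rvec_simps ..
  have W_rvec: "W \<bullet> rvec x = of_rat (r * (\<Sum>i\<in>UNIV. q$i * x$i))" for x
    unfolding W by (simp add: inner_vec_def rvec_def of_rat_mult of_rat_sum sum_distrib_left mult.assoc)
  have WV: "W \<bullet> (x *\<^sub>R V1 + y *\<^sub>R V2 + z *\<^sub>R V3) = of_rat r * z" for x y z
    using W_rvec[of v1] W_rvec[of v2] W_rvec[of v3] qv[of 1 0 0] qv[of 0 1 0] qv[of 0 0 1]
    by (simp add: V_defs inner_add_right)
  have WA: "W \<bullet> (realmat (A l) *v x) = e1 l * e2 l * (W \<bullet> x)" for l x
  proof -
    obtain a b c where x: "x = a *\<^sub>R V1 + b *\<^sub>R V2 + c *\<^sub>R V3" using expand by blast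
    show ?thesis unfolding x AV WV by simp
  qed
  have W_int: "\<exists>n. W \<bullet> real_of_intvec x = real_of_int n" for x
    by (intro exI[of _ "\<Sum>i\<in>UNIV. w$i * x$i"]) (simp add: W_def inner_vec_def real_of_intvec_def)
  have W_u: "W \<bullet> real_of_intvec u = 1"
    using arg_cong[OF u, of real_of_int]
    by (simp add: W_def inner_vec_def real_of_intvec_def sum_3 mult.commute)
  obtain \<alpha>' \<beta>' \<gamma>' where u': "(\<chi> i. of_int (u$i)) = \<alpha>' *s v1 + \<beta>' *s v2 + \<gamma>' *s v3"
    using ind by (rule indep3_span)
  define \<alpha> \<beta> \<gamma> where "\<alpha> = real_of_rat \<alpha>'" and "\<beta> = real_of_rat \<beta>'" and "\<gamma> = real_of_rat \<gamma>'"
  have uV: "real_of_intvec u = \<alpha> *\<^sub>R V1 + \<beta> *\<^sub>R V2 + \<gamma> *\<^sub>R V3"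
    unfolding rvec_intvec[symmetric] u' by (simp add: rvec_simps V_defs \<alpha>_def \<beta>_def \<gamma>_def)
  have r\<gamma>: "of_rat r * \<gamma> = 1" using W_u unfolding uV WV .

  \<comment> \<open>The lattice need not be spanned by eigenvectors, so the translations below are
    multiples of the eigencomponents of a lattice vector \<open>u\<close> with \<open>W \<bullet> u = 1\<close>. They form a
    cocycle only modulo the lattice: the coordinates of the defect in the eigencomponents of \<open>u\<close>
    are integers of equal parity, and twice an eigencomponent is a lattice vector.\<close>
  define L where "L = range real_of_intvec"
  have L_add: "x + y \<in> L" if "x \<in> L" "y \<in> L" for x y
    using that unfolding L_def by (auto simp flip: real_of_intvec_add)
  have L_scale: "real_of_int n *\<^sub>R x \<in> L" if x: "x \<in> L" for n x
  proof -
    obtain k where "x = real_of_intvec k" using x by (auto simp: L_def)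
    then have "real_of_int n *\<^sub>R x = real_of_intvec (n *s k)"
      by (simp add: real_of_intvec_def vec_eq_iff)
    then show ?thesis by (simp add: L_def)
  qed
  have L_u: "real_of_intvec u \<in> L" by (simp add: L_def)
  have L_A: "realmat (A l) *v x \<in> L" if "x \<in> L" for l x
    using that by (auto simp: L_def realmat_intvec)
  \<comment> \<open>\<open>k + m\<close> acts with signs 1, -1, -1, so adding the image of
    \<open>u\<close> to \<open>u\<close> leaves twice its first component; \<open>k\<close> does the
    same for the second.\<close>
  have L1: "(2 * \<alpha>) *\<^sub>R V1 \<in> L"
  proof -
    have "e1 (k + m) = 1" "e2 (k + m) = -1" by (simp_all add: e_hom e_km)
    then have "real_of_intvec u + realmat (A (k + m)) *v real_of_intvec u = (2 * \<alpha>) *\<^sub>R V1"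
      unfolding uV AV by (simp add: vec_eq_iff algebra_simps)
    then show ?thesis using L_add[OF L_u L_A[OF L_u]] by metis
  qed
  have L2: "(2 * \<beta>) *\<^sub>R V2 \<in> L"
  proof -
    have "real_of_intvec u + realmat (A k) *v real_of_intvec u = (2 * \<beta>) *\<^sub>R V2"
      unfolding uV AV e_km by (simp add: vec_eq_iff algebra_simps)
    then show ?thesis using L_add[OF L_u L_A[OF L_u]] by metis
  qed
  have L_parity: "(of_int N1 * \<alpha>) *\<^sub>R V1 + (of_int N2 * \<beta>) *\<^sub>R V2 + (of_int N3 * \<gamma>) *\<^sub>R V3 \<in> L"
    if par: "even (N1 - N3)" "even (N2 - N3)" for N1 N2 N3
  proof -
    obtain j1 j2 where j: "N1 = N3 + 2 * j1" "N2 = N3 + 2 * j2"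
      using par by (metis add.commute diff_add_cancel evenE)
    have "real_of_int N3 *\<^sub>R real_of_intvec u + real_of_int j1 *\<^sub>R (2 * \<alpha>) *\<^sub>R V1
        + real_of_int j2 *\<^sub>R (2 * \<beta>) *\<^sub>R V2 \<in> L"
      by (intro L_add L_scale L_u L1 L2)
    then show ?thesis unfolding uV j by (simp add: algebra_simps)
  qed

  obtain \<kappa> :: real and \<tau> :: "int^'p \<Rightarrow> real" where \<tau>: "\<And>l m. \<tau> (l + m) = \<tau> l + \<tau> m"
    and \<tau>_sq: "\<And>l. (\<tau> l)\<^sup>2 \<in> \<rat> \<Longrightarrow> l = 0"
    using exists_generic_frequencies by metis
  \<comment> \<open>The zero \<open>V3\<close> term gives the field the shape to which
    \<open>AV\<close> and \<open>WV\<close> apply.\<close>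
  define Y where "Y x = cos ((2 * pi) *\<^sub>R W \<bullet> x) *\<^sub>R V1 + sin ((2 * pi) *\<^sub>R W \<bullet> x) *\<^sub>R V2 + 0 *\<^sub>R V3" for x
  \<comment> \<open>The \<open>V3\<close> component shifts the phase by half a turn exactly when
    \<open>e1 l = -1\<close>, so that cosine and sine acquire the signs \<open>e1 l\<close> and
    \<open>e2 l\<close>. The other two components give the composition defect coordinates of equal
    parity.\<close>
  define s where "s l = (- of_int (n2 l) * \<alpha> / 2) *\<^sub>R V1 + (e2 l * of_int (n1 l) * \<beta> / 2) *\<^sub>R V2
      + (e2 l * (1 - e1 l) * \<gamma> / 4) *\<^sub>R V3" for l
  \<comment> \<open>As \<open>W\<close> kills \<open>Y\<close>, the field is constant along its
    orbits, so its flow moves \<open>x\<close> by \<open>\<tau> l *\<^sub>R Y x\<close>; the affine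
    map is applied afterwards.\<close>
  define F where "F l x = realmat (A l) *v x + s l + \<tau> l *\<^sub>R (realmat (A l) *v Y x)" for l x
  have F_trig: "F l = (\<lambda>x. realmat (A l) *v x + s l + (cos ((2 * pi) *\<^sub>R W \<bullet> x) *\<^sub>R (\<tau> l * e1 l) *\<^sub>R V1
      + sin ((2 * pi) *\<^sub>R W \<bullet> x) *\<^sub>R (\<tau> l * e2 l) *\<^sub>R V2))" for l
    unfolding F_def Y_def AV by (simp add: fun_eq_iff algebra_simps)
  have WF: "W \<bullet> F l x = e1 l * e2 l * (W \<bullet> x) + e2 l * (1 - e1 l) / 4" for l x
  proof -
    have "W \<bullet> Y x = 0" unfolding Y_def WV by simp
    moreover have "W \<bullet> s l = e2 l * (1 - e1 l) * (of_rat r * \<gamma>) / 4" unfolding s_def WV by simp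
    ultimately show ?thesis unfolding F_def by (simp add: inner_add_right WA r\<gamma>)
  qed
  have YF: "Y (F l x) = realmat (A l) *v Y x" for l x
  proof -
    define t where "t = (2 * pi) *\<^sub>R W \<bullet> x"
    have t: "(2 * pi) *\<^sub>R W \<bullet> F l x = e1 l * e2 l * t + e2 l * (1 - e1 l) * (pi / 2)"
      by (simp add: WF t_def field_simps)
    have "cos (e1 l * e2 l * t + e2 l * (1 - e1 l) * (pi / 2)) = e1 l * cos t"
      "sin (e1 l * e2 l * t + e2 l * (1 - e1 l) * (pi / 2)) = e2 l * sin t"
      by (simp_all add: e1_def e2_def cos_add sin_add cos_diff sin_diff)
    then show ?thesis unfolding Y_def AV t t_def[symmetric] by simp
  qed
  have Y_per: "Y (x + real_of_intvec k) = Y x" for x k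
  proof -
    obtain n where n: "W \<bullet> real_of_intvec k = real_of_int n" using W_int by blast
    have "(2 * pi) *\<^sub>R W \<bullet> (x + real_of_intvec k) = (2 * pi) *\<^sub>R W \<bullet> x + 2 * pi * of_int n"
      by (simp add: inner_add_right n algebra_simps)
    then show ?thesis unfolding Y_def by (simp add: cos_add sin_add)
  qed
  have realA: "realmat (A (l + m)) *v x = realmat (A l) *v (realmat (A m) *v x)" for l m x
    by (simp add: hom map_matrix_of_int_mult matrix_vector_mul_assoc)
  \<comment> \<open>By \<open>YF\<close> the affine parts transport the field equivariantly, so the
    flow times simply add up.\<close>
  have FF: "F l (F m x) = realmat (A (l + m)) *v x + (realmat (A l) *v s m + s l)
      + \<tau> (l + m) *\<^sub>R (realmat (A (l + m)) *v Y x)" for l m x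
    unfolding F_def[of l] YF realA[symmetric] unfolding F_def[of m]
    by (simp add: matrix_vector_right_distrib matrix_vector_mult_scaleR realA \<tau> algebra_simps)
  have F_per: "F l (x + real_of_intvec k) = F l x + real_of_intvec (A l *v k)" for l x k
    unfolding F_def by (simp add: Y_per matrix_vector_right_distrib realmat_intvec)
  show ?thesis
  proof (rule action_from_lifts[of F])
    show "F l (x + real_of_intvec k) = F l x + real_of_intvec (A l *v k)" for l x k by (rule F_per)
    show "real_analytic (F l)" for l unfolding F_trig by (rule real_analytic_affine_trig)
    show "continuous_on UNIV (F l)" for l
      unfolding F_trig by (intro continuous_intros matrix_vector_mult_linear_continuous_on)
    have "n1 0 = 0" "n2 0 = 0" "\<tau> 0 = 0" using n1(1)[of 0 0] n2(1)[of 0 0] \<tau>[of 0 0] by simp_all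
    then show "F 0 x = x" for x
      by (simp add: F_def s_def one map_matrix_of_int_one e1_def)
    show "\<exists>k. F (l + m) x = F l (F m x) + real_of_intvec k" for l m x
    proof -
      define d where "d = s (l + m) - (realmat (A l) *v s m + s l)"
      \<comment> \<open>All three integers \<open>N1\<close>, \<open>N2\<close>, \<open>N3\<close>
        are congruent to \<open>n1 l * n2 m\<close> modulo 2.\<close>
      define N1 where "N1 = (if even (n1 l) then 0 else - n2 m)"
      define N2 where "N2 = (if even (n2 m) then 0 else - e2 l * n1 l)"
      define N3 where "N3 = (if even (n1 l) \<or> even (n2 m) then 0 else - e2 l)"
      have "d = (of_int N1 * \<alpha>) *\<^sub>R V1 + (of_int N2 * \<beta>) *\<^sub>R V2 + (of_int N3 * \<gamma>) *\<^sub>R V3"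
      proof -
        have "d = ((- of_int (n2 (l + m)) + e1 l * of_int (n2 m) + of_int (n2 l)) / 2 * \<alpha>) *\<^sub>R V1
          + ((e2 (l + m) * of_int (n1 (l + m)) - e2 l * e2 m * of_int (n1 m) - e2 l * of_int (n1 l)) / 2 * \<beta>) *\<^sub>R V2
          + ((e2 (l + m) * (1 - e1 (l + m)) - e1 l * e2 l * e2 m * (1 - e1 m) - e2 l * (1 - e1 l)) / 4 * \<gamma>) *\<^sub>R V3"
          unfolding d_def s_def AV by (simp add: algebra_simps diff_divide_distrib add_divide_distrib)
        moreover have "(- of_int (n2 (l + m)) + e1 l * of_int (n2 m) + of_int (n2 l)) / 2 = real_of_int N1"
          by (simp add: N1_def n2 e1_def)
        moreover have "(e2 (l + m) * of_int (n1 (l + m)) - e2 l * e2 m * of_int (n1 m) - e2 l * of_int (n1 l)) / 2 = real_of_int N2"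
          unfolding e_hom n1 by (simp add: N2_def e2_def[of m] algebra_simps)
        moreover have "(e2 (l + m) * (1 - e1 (l + m)) - e1 l * e2 l * e2 m * (1 - e1 m) - e2 l * (1 - e1 l)) / 4 = real_of_int N3"
          unfolding e_hom by (simp add: N3_def e2_def[of m] e1_def[of l] algebra_simps)
        ultimately show ?thesis by metis
      qed
      moreover have "even (N1 - N3)" "even (N2 - N3)"
        by (auto simp: N1_def N2_def N3_def e2_def)
      ultimately have "d \<in> L" using L_parity by metis
      then obtain j where "d = real_of_intvec j" by (auto simp: L_def)
      then have "F (l + m) x = F l (F m x) + real_of_intvec j"
        unfolding FF by (simp add: F_def d_def algebra_simps)
      then show ?thesis ..
    qed
    \<comment> \<open>A fixed point of \<open>F l\<close> is fixed by \<open>F l \<circ> F l\<close>, which is a rational translation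
      followed by the flow at time \<open>2 * \<tau> l\<close>.\<close>
    show "F l x \<noteq> x + real_of_intvec k" if l: "l \<noteq> 0" for l x k
    proof
      assume fixed: "F l x = x + real_of_intvec k"
      then have "F l (F l x) = x + real_of_intvec (k + A l *v k)"
        by (simp add: F_per real_of_intvec_add)
      moreover have involution: "realmat (A (l + l)) *v y = y" for y
      proof -
        obtain a b c where y: "y = a *\<^sub>R V1 + b *\<^sub>R V2 + c *\<^sub>R V3" using expand by blast
        show ?thesis unfolding y AV e_hom e_sq by simp
      qed
      ultimately have eq: "(realmat (A l) *v s l + s l) + (2 * \<tau> l) *\<^sub>R Y x = real_of_intvec (k + A l *v k)"
        unfolding FF \<tau>[of l l] by (simp add: algebra_simps)
      define t where "t = (2 * pi) *\<^sub>R W \<bullet> x"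
      define p1 p2 p3 where "p1 = (e1 l + 1) * (- of_int (n2 l) * \<alpha> / 2)"
        and "p2 = (e2 l + 1) * (e2 l * of_int (n1 l) * \<beta> / 2)"
        and "p3 = (e1 l * e2 l + 1) * (e2 l * (1 - e1 l) * \<gamma> / 4)"
      have "(p1 + 2 * \<tau> l * cos t) *\<^sub>R V1 + (p2 + 2 * \<tau> l * sin t) *\<^sub>R V2 + p3 *\<^sub>R V3
          = real_of_intvec (k + A l *v k)"
        unfolding eq[symmetric] s_def AV Y_def t_def[symmetric] p1_def p2_def p3_def
        by (simp add: algebra_simps add_divide_distrib diff_divide_distrib)
      then have "p1 + 2 * \<tau> l * cos t \<in> \<rat>" "p2 + 2 * \<tau> l * sin t \<in> \<rat>"
        unfolding V_defs by (rule rational_coords[OF ind])+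
      moreover have "p1 \<in> \<rat>" "p2 \<in> \<rat>" by (auto simp: p1_def p2_def \<alpha>_def \<beta>_def)
      ultimately have "2 * \<tau> l * cos t \<in> \<rat>" "2 * \<tau> l * sin t \<in> \<rat>"
        using Rats_diff by fastforce+
      \<comment> \<open>Summing squares eliminates the unknown phase \<open>t\<close>.\<close>
      then have "((2 * \<tau> l * cos t)\<^sup>2 + (2 * \<tau> l * sin t)\<^sup>2) / 4 \<in> \<rat>"
        by (intro Rats_divide Rats_add Rats_power) auto
      also have "((2 * \<tau> l * cos t)\<^sup>2 + (2 * \<tau> l * sin t)\<^sup>2) / 4 = (\<tau> l)\<^sup>2"
        by (simp add: power_mult_distrib cos_squared_eq algebra_simps)
      finally have "(\<tau> l)\<^sup>2 \<in> \<rat>" .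
      with \<tau>_sq l show False by blast
    qed
  qed
qed

section \<open>Reduction to the Klein, transverse and flag constructions\<close>

theorem theorem1:
  fixes A :: "int^'p::finite \<Rightarrow> int^3^3"
  assumes "CARD('p) \<ge> 2"
    and "spectrally_unitary A"
  shows "\<exists>\<phi> :: int^'p \<Rightarrow> torus \<Rightarrow> torus.
           real_analytic_action \<phi> \<and> free_action \<phi> \<and> (\<forall>l. H1_induced (\<phi> l) = A l)"
proof -
  have inv: "\<And>l. invertible (A l)" and hom: "\<And>l m. A (l + m) = A l ** A m"
    and eig: "\<And>l. has_eigenvalue_one (A l)"
    using assms(2) by (simp_all add: spectrally_unitary_def)
  have one: "A 0 = mat 1"
  proof -
    obtain N where "N ** A 0 = mat 1" using inv unfolding invertible_def by blast
    moreover have "A 0 ** A 0 = A 0" using hom[of 0 0] by simp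
    ultimately show ?thesis by (metis matrix_mul_assoc matrix_mul_lid)
  qed
  define M where "M l = ratmat (A l)" for l
  have M_hom: "M (l + m) = M l ** M m" for l m
    by (simp add: M_def hom map_matrix_of_int_mult)
  have M_comm: "M l ** M m = M m ** M l" for l m by (metis M_hom add.commute)
  have M_fix: "\<exists>v. v \<noteq> 0 \<and> M l *v v = v" for l
    using eig unfolding has_eigenvalue_one_rat M_def by blast
  have M_eigen: "c = 1 \<or> c = -1" if "v \<noteq> 0" "M l *v v = c *s v" for l v c
    using invertible_int_eigenvalue[OF inv] that unfolding M_def by blast
  have inv_transpose: "invertible (transpose (A l))" for l
    using inv[of l] unfolding invertible_def by (metis matrix_transpose_mul transpose_mat)
  have T_hom: "transpose (M (l + m)) = transpose (M l) ** transpose (M m)" for l m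
    by (metis M_comm M_hom matrix_transpose_mul)
  have T_fix: "\<exists>v. v \<noteq> 0 \<and> transpose (M l) *v v = v" for l
  proof -
    have "transpose (M l) - mat 1 = transpose (M l - mat 1)"
      by (simp add: transpose_def mat_def vec_eq_iff)
    then show ?thesis using M_fix[of l]
      unfolding fixed_vector_iff_det by (simp add: det_transpose)
  qed
  have T_eigen: "c = 1 \<or> c = -1" if "v \<noteq> 0" "transpose (M l) *v v = c *s v" for l v c
    using invertible_int_eigenvalue[OF inv_transpose that(1)] that(2)
    unfolding M_def map_matrix_of_int_transpose by blast
  have M_det: "det (M l) = 1 \<or> det (M l) = -1" for l
  proof -
    obtain N where "A l ** N = mat 1" using inv unfolding invertible_def by blast
    then have "det (A l) * det N = 1" by (metis det_I det_mul)
    then have "det (A l) = 1 \<or> det (A l) = -1" by (auto simp: zmult_eq_1_iff)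
    then show ?thesis unfolding M_def det_of_int by auto
  qed
  show ?thesis
  proof (cases "\<exists>v. v \<noteq> 0 \<and> (\<forall>l. M l *v v = v)")
    case False
    then have "\<And>v. v \<noteq> 0 \<Longrightarrow> \<exists>l. M l *v v \<noteq> v" by blast
    note no_common = this
    obtain v1 v2 v3 c1 c2 c3 k m where ind: "indep3 v1 v2 v3"
      and Mv: "\<And>l. M l *v v1 = c1 l *s v1" "\<And>l. M l *v v2 = c2 l *s v2" "\<And>l. M l *v v3 = c3 l *s v3"
      and k: "c1 k = -1" "c2 k = 1" "c3 k = -1" and m: "c1 m = -1" "c2 m = -1" "c3 m = 1"
    proof (rule commuting_fixing_family_structure[of M, OF M_hom M_fix], goal_cases)
      case 1 then show ?case using M_eigen by blast
    next
      case 2 then show ?case using no_common by blast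
    next
      case 3 show ?case by (rule 3(1)[OF 3(2-)])
    qed
    have nz: "v1 \<noteq> 0" "v2 \<noteq> 0" "v3 \<noteq> 0" using ind by (rule indep3_nonzero)+
    have c_pm: "c1 l = 1 \<or> c1 l = -1" "c2 l = 1 \<or> c2 l = -1" "c3 l = 1 \<or> c3 l = -1" for l
      using M_eigen nz Mv by blast+
    have c_fix: "c1 l = 1 \<or> c2 l = 1 \<or> c3 l = 1" for l
    proof -
      obtain v where v: "v \<noteq> 0" "M l *v v = v" using M_fix by blast
      obtain a b c where abc: "v = a *s v1 + b *s v2 + c *s v3" using ind by (rule indep3_span)
      then have "(c1 l * a) *s v1 + (c2 l * b) *s v2 + (c3 l * c) *s v3 = a *s v1 + b *s v2 + c *s v3"
        using v(2) by (simp add: matrix_vector_right_distrib mvmult_lin Mv mult.commute)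
      from indep3_coords_eq[OF ind this] have "c1 l = 1 \<or> a = 0" "c2 l = 1 \<or> b = 0" "c3 l = 1 \<or> c = 0" by auto
      then show ?thesis using v(1) abc by auto
    qed
    have c_hom: "c1 (l + j) = c1 l * c1 j" "c2 (l + j) = c2 l * c2 j" "c3 (l + j) = c3 l * c3 j" for l j
    proof -
      have "M (l + j) *v x = M l *v (M j *v x)" for x by (simp add: M_hom matrix_vector_mul_assoc)
      from this[of "1 *s v1 + 1 *s v2 + 1 *s v3"]
      have "c1 (l + j) *s v1 + c2 (l + j) *s v2 + c3 (l + j) *s v3
        = (c1 l * c1 j) *s v1 + (c2 l * c2 j) *s v2 + (c3 l * c3 j) *s v3"
        by (simp add: matrix_vector_right_distrib mvmult_lin Mv mult.commute)
      from indep3_coords_eq[OF ind this]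
      show "c1 (l + j) = c1 l * c1 j" "c2 (l + j) = c2 l * c2 j" "c3 (l + j) = c3 l * c3 j" .
    qed
    \<comment> \<open>If the three signs of \<open>l\<close> had product -1, one of
      \<open>l\<close>, \<open>l + k\<close>, \<open>l + m\<close>, \<open>l + (k + m)\<close> would
      have all signs -1 and fix no nonzero vector.\<close>
    have "c3 l = c1 l * c2 l" for l
      using c_pm[of l] c_fix[of l] c_fix[of "l + k"] c_fix[of "l + m"] c_fix[of "l + (k + m)"]
      unfolding c_hom k m by auto
    from klein_action[OF hom one ind Mv[unfolded M_def] c_pm(1,2) this k(1,2) m(1,2)]
    show ?thesis .
  next
    case True
    then obtain v where v: "v \<noteq> 0" "\<And>l. M l *v v = v" by blast
    \<comment> \<open>Otherwise the transposes have an eigenbasis each member of which is negated by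
      some element. Pairing with \<open>v\<close> is invariant, so it vanishes on this basis,
      forcing \<open>v = 0\<close>.\<close>
    have "\<exists>w. w \<noteq> 0 \<and> (\<forall>l. transpose (M l) *v w = w)"
    proof (rule ccontr)
      assume "\<not> ?thesis"
      then have "\<And>w. w \<noteq> 0 \<Longrightarrow> \<exists>l. transpose (M l) *v w \<noteq> w" by blast
      note no_common = this
      obtain w1 w2 w3 c1 c2 c3 k m where ind: "indep3 w1 w2 w3"
        and Tw: "\<And>l. transpose (M l) *v w1 = c1 l *s w1" "\<And>l. transpose (M l) *v w2 = c2 l *s w2"
          "\<And>l. transpose (M l) *v w3 = c3 l *s w3"
        and km: "c1 k = -1" "c3 k = -1" "c2 m = -1"
      proof (rule commuting_fixing_family_structure[of "\<lambda>l. transpose (M l)", OF T_hom T_fix], goal_cases)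
        case 1 then show ?case using T_eigen by blast
      next
        case 2 then show ?case using no_common by blast
      next
        case (3 w1 w2 w3 c1 c2 c3 k m) show ?case by (rule 3(1)[of w1 w2 w3 c1 c2 c3 k m]) (rule 3)+
      qed
      define f where "f w = (\<Sum>i\<in>UNIV. w$i * v$i)" for w
      have f_lin: "f (x + y) = f x + f y" "f (c *s x) = c * f x" for x y c
        by (simp_all add: f_def sum.distrib distrib_right sum_distrib_left mult.assoc)
      have "f (transpose (M l) *v w) = f w" for l w
      proof -
        have "f (transpose (M l) *v w) = (\<Sum>i\<in>UNIV. w$i * (M l *v v)$i)"
          unfolding f_def matrix_vector_mult_def transpose_def by (simp add: sum_3 algebra_simps)
        then show ?thesis by (simp add: v f_def)
      qed
      then have "f w = c * f w" if "transpose (M l) *v w = c *s w" for l w c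
        using that f_lin(2) by metis
      from this[OF Tw(1)[of k]] this[OF Tw(2)[of m]] this[OF Tw(3)[of k]]
      have f0: "f w1 = 0" "f w2 = 0" "f w3 = 0" by (simp_all add: km)
      obtain i where i: "v$i \<noteq> 0" using v(1) by (auto simp: vec_eq_iff)
      obtain a b c where "axis i 1 = a *s w1 + b *s w2 + c *s w3" using ind by (rule indep3_span)
      then have "f (axis i 1) = 0" by (simp add: f_lin f0)
      moreover have "f (axis i 1) = v$i" by (simp add: f_def axis_def if_distrib if_distribR cong: if_cong)
      ultimately show False using i by simp
    qed
    then obtain w where w: "w \<noteq> 0" "\<And>l. w v* M l = w" by auto
    show ?thesis
    proof (cases "(\<Sum>i\<in>UNIV. w$i * v$i) = 0")
      case False
      show ?thesis
        by (rule transverse_affine_action[OF hom one v(2)[unfolded M_def] w(2)[unfolded M_def] False])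
    next
      case True
      note decomposition = fixed_flag_structure[of M, OF M_hom M_det v w True]
      obtain y z a b c e where "indep3 v y z"
        "\<And>l. M l *v y = e l *s y + a l *s v" "\<And>l. M l *v z = z + b l *s y + c l *s v"
        "(\<forall>l. e l = 1) \<or> (\<forall>l. a l = 0 \<and> b l = 0)" by (rule decomposition) (rule that)
      then show ?thesis
        using flag_action[OF hom one _ v(2)[unfolded M_def], of y z e a b c] unfolding M_def by blast
    qed
  qed
qed

end
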